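(* Let $L:A\to\mathbb R$ be a linear functional with $L(1)=1$. Then there exists a unique representing measure $\nu_L$ for $L$ with compact support if and only if $$C_a=\sup_{n\in\mathbb N}\sqrt[2n]{L(a^{2n})}<\infty\quad\text{for all }a\in A$$ and $$L\big((C_a-a)^j(C_a+a)^k\big)\ge 0\quad\text{for all }a\in A \text{ and all integers } j,k\ge 0.$$
   Context: $A$ is a unital commutative $\mathbb R$-algebra and $X(A)$ is the set of all (unital) $\mathbb R$-algebra homomorphisms $A\to\mathbb R$, assumed non-empty and endowed with the topology of pointwise convergence. $\mathbb N=\{1,2,\dots\}$. Real numbers are regarded as elements of $A$ via $\lambda\mapsto\lambda\cdot 1$. A representing measure for $L$ is a positive Radon measure $\mu$ on $X(A)$ such that $L(a)=\int\alpha(a)\,d\mu(\alpha)$ for all $a\in A$. The condition $C_a<\infty$ is understood to include that the real roots are defined, i.e. that $L(a^{2n})\ge 0$ for all $n\in\mathbb N$. *)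

theory Defs
  imports "HOL-Analysis.Analysis"
begin

definition characters :: "('a::{comm_ring_1, real_algebra_1} \<Rightarrow> real) set" where
  "characters = {\<alpha>. linear \<alpha> \<and> \<alpha> 1 = 1 \<and> (\<forall>x y. \<alpha> (x * y) = \<alpha> x * \<alpha> y)}"

(* The product topology on real-valued functions is that of pointwise convergence. *)
definition character_topology :: "('a::{comm_ring_1, real_algebra_1} \<Rightarrow> real) topology" where
  "character_topology = subtopology (product_topology (\<lambda>_. euclideanreal) UNIV) characters"

(* Borel measures that are locally finite and inner regular with respect to compact sets.
   The notion is meant for Hausdorff spaces, where compact sets are closed, hence measurable. *)
definition radon_measure_on :: "'x topology \<Rightarrow> 'x measure \<Rightarrow> bool" where
  "radon_measure_on T \<mu> \<longleftrightarrow>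
     space \<mu> = topspace T \<and>
     sets \<mu> = sigma_sets (topspace T) {U. openin T U} \<and>
     (\<forall>x\<in>topspace T. \<exists>U. openin T U \<and> x \<in> U \<and> emeasure \<mu> U < \<infinity>) \<and>
     (\<forall>B\<in>sets \<mu>. emeasure \<mu> B = (SUP K\<in>{K. compactin T K \<and> K \<subseteq> B}. emeasure \<mu> K))"

definition measure_support :: "'x topology \<Rightarrow> 'x measure \<Rightarrow> 'x set" where
  "measure_support T \<mu> = {x \<in> topspace T. \<forall>U. openin T U \<and> x \<in> U \<longrightarrow> 0 < emeasure \<mu> U}"

(* Integrability is required explicitly, since the Bochner integral of a non-integrable
   function is 0 by convention. *)
definition representing_measure ::
    "('a::{comm_ring_1, real_algebra_1} \<Rightarrow> real) \<Rightarrow> ('a \<Rightarrow> real) measure \<Rightarrow> bool" where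
  "representing_measure L \<mu> \<longleftrightarrow>
     radon_measure_on character_topology \<mu> \<and>
     (\<forall>a. integrable \<mu> (\<lambda>\<alpha>. \<alpha> a) \<and> L a = (\<integral>\<alpha>. \<alpha> a \<partial>\<mu>))"

definition root_sup :: "('a::{comm_ring_1, real_algebra_1} \<Rightarrow> real) \<Rightarrow> 'a \<Rightarrow> ereal" where
  "root_sup L a = (SUP n\<in>{1::nat..}. ereal (root (2 * n) (L (a ^ (2 * n)))))"

(* The library's root of a negative number is a negative number even for even exponents, so
   the nonnegativity making the real roots defined is a separate conjunct. *)
definition root_sup_finite :: "('a::{comm_ring_1, real_algebra_1} \<Rightarrow> real) \<Rightarrow> 'a \<Rightarrow> bool" where
  "root_sup_finite L a \<longleftrightarrow> (\<forall>n\<ge>1. 0 \<le> L (a ^ (2 * n))) \<and> root_sup L a < \<infinity>"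

(* Meaningful only under root_sup_finite: real_of_ereal maps infinity to 0. *)
definition C_const :: "('a::{comm_ring_1, real_algebra_1} \<Rightarrow> real) \<Rightarrow> 'a \<Rightarrow> real" where
  "C_const L a = real_of_ereal (root_sup L a)"

end

theory Submission
  imports Defs
begin

text \<open>
  Suppose that \<open>\<nu>\<close> represents \<open>L\<close> and lives on a compact set of characters. Every evaluation
  \<open>\<alpha> \<mapsto> \<alpha> a\<close> is bounded there, so the roots of the moments \<open>L (a^(2 n)) = \<integral> \<alpha> a ^ (2 n) d\<nu>\<close> are bounded.
  Markov's inequality for these moments shows conversely that \<open>\<bar>\<alpha> a\<bar> \<le> C\<^sub>a\<close> holds \<open>\<nu>\<close>-almost everywhere
  (\<open>moment_bound_AE\<close>): \<open>C\<^sub>a\<close> is the essential supremum of \<open>\<bar>\<alpha> a\<bar>\<close>. The integrand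
  \<open>(C\<^sub>a - \<alpha> a)^j (C\<^sub>a + \<alpha> a)^k\<close> is therefore nonnegative almost everywhere, and so is its integral.

  For the converse direction, the growth condition makes \<open>L\<close> positive on squares, and a log-convexity
  argument (\<open>psd_growth_bound\<close>) turns it into \<open>L (b\<^sup>2 x\<^sup>2) \<le> C\<^sub>b\<^sup>2 L (x\<^sup>2)\<close>: in the GNS picture,
  multiplication by \<open>b\<close> is an operator of norm at most \<open>C\<^sub>b\<close>. The normalised functionals that are positive
  on squares and satisfy these bounds form a set of states which is compact for pointwise convergence.
  Its extreme points are characters (\<open>extreme_state_multiplicative\<close>): for small \<open>b\<close>, a state \<open>e\<close> is a convex
  combination of the states obtained by normalising \<open>x \<mapsto> e ((1 + b) x)\<close> and \<open>x \<mapsto> e ((1 - b) x)\<close>.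
  Since each evaluation attains its minimum over the states at an extreme point, \<open>L a \<ge> 0\<close> whenever \<open>\<alpha> a \<ge> 0\<close>
  for all characters \<open>\<alpha>\<close> in the compact set \<open>K\<close> given by \<open>\<bar>\<alpha> b\<bar> \<le> C\<^sub>b\<close> for all \<open>b\<close> (\<open>state_nonneg\<close>).

  Thus \<open>L\<close> is a positive functional on the algebra of evaluations on \<open>K\<close>, which separates points, and a
  Riesz representation theorem for such algebras yields the measure (\<open>\<Lambda>_eq_integral\<close>). The space \<open>K\<close> need
  not be metrisable, so the measure is built from a content on compact sets, which also gives inner
  regularity. The same approximate separation of disjoint compact sets by evaluations, taken from the
  proof of the Stone--Weierstrass theorem, shows that two representing measures with compact support
  agree on compact sets and hence, by inner regularity, everywhere (\<open>representing_measure_unique\<close>).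
\<close>

section \<open>Functionals that are positive on squares\<close>

lemma psd_Cauchy_Schwarz:
  fixes l :: "'a::{comm_ring_1, real_algebra_1} \<Rightarrow> real"
  assumes l: "linear l" and psd: "\<And>x. 0 \<le> l (x^2)"
  shows "(l (x * y))^2 \<le> l (x^2) * l (y^2)"
proof -
  interpret linear l by (rule l)
  have q: "0 \<le> l (x^2) + 2 * t * l (x * y) + t^2 * l (y^2)" for t
  proof -
    have "(x + t *\<^sub>R y)^2 = x^2 + (2*t) *\<^sub>R (x*y) + t^2 *\<^sub>R y^2"
      by (simp add: power2_eq_square algebra_simps scaleR_2 flip: scaleR_scaleR)
    then show ?thesis using psd[of "x + t *\<^sub>R y"] by (simp add: add scale)
  qed
  show ?thesis
  proof (cases "l (y^2) = 0")
    case True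
    have "l (x*y) = 0"
    proof (rule ccontr)
      assume n: "l (x*y) \<noteq> 0"
      have "0 \<le> l (x^2) + 2 * (-(l (x^2) + 1) / (2 * l (x*y))) * l (x*y)"
        using q[of "-(l (x^2) + 1) / (2 * l (x*y))"] True by simp
      also have "\<dots> = -1" using n by (simp add: field_simps)
      finally show False by simp
    qed
    then show ?thesis using True by simp
  next
    case False
    then have pos: "0 < l (y^2)" using psd[of y] by simp
    have "0 \<le> l (x^2) + 2 * (- l (x*y) / l (y^2)) * l (x*y) + (- l (x*y) / l (y^2))^2 * l (y^2)"
      by (rule q)
    also have "\<dots> = l (x^2) - (l (x*y))^2 / l (y^2)"
      using False by (simp add: field_simps power2_eq_square)
    finally show ?thesis using pos by (simp add: field_simps)
  qed
qed

text \<open>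
  The numbers \<open>s n = l (b^(2 n) x\<^sup>2)\<close> form a log-convex sequence by the Cauchy--Schwarz inequality, so their
  consecutive quotients increase. If the first quotient \<open>s 1 / s 0\<close> were larger than \<open>r\<close>, the sequence would
  grow at least like a geometric sequence of larger ratio. A second use of Cauchy--Schwarz separates
  \<open>b^(2 n)\<close> from \<open>x\<^sup>2\<close> and bounds \<open>s n\<close> by a multiple of \<open>r^n\<close>. The constant \<open>M\<close> disappears from the
  conclusion, as in a spectral radius formula.
\<close>

lemma psd_growth_bound:
  fixes l :: "'a::{comm_ring_1, real_algebra_1} \<Rightarrow> real"
  assumes l: "linear l" and psd: "\<And>x. 0 \<le> l (x^2)" and r: "0 \<le> r"
    and growth: "\<And>n::nat. 1 \<le> n \<Longrightarrow> l (b^(2*n)) \<le> M * r^n"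
  shows "l (b^2 * x^2) \<le> r * l (x^2)"
proof -
  define s where "s n = l ((b^n * x)^2)" for n
  have s0: "0 \<le> s n" for n unfolding s_def by (rule psd)
  have logconvex: "(s (Suc n))^2 \<le> s n * s (Suc (Suc n))" for n
  proof -
    have "(l ((b^n * x) * (b^(n+2) * x)))^2 \<le> s n * s (n+2)"
      unfolding s_def by (rule psd_Cauchy_Schwarz[OF l psd])
    moreover have "(b^n * x) * (b^(n+2) * x) = (b^(Suc n) * x)^2"
      by (simp add: power2_eq_square algebra_simps)
    ultimately show ?thesis by (simp add: s_def)
  qed
  have upper: "(s n)^2 \<le> (M * l ((x^2)^2)) * (r^2)^n" if "1 \<le> n" for n
  proof -
    have "(l (b^(2*n) * x^2))^2 \<le> l ((b^(2*n))^2) * l ((x^2)^2)"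
      by (rule psd_Cauchy_Schwarz[OF l psd])
    also have "(b^(2*n))^2 = b^(2*(2*n))" by (simp flip: power_mult add: mult_ac)
    also have "l (b^(2*(2*n))) * l ((x^2)^2) \<le> (M * r^(2*n)) * l ((x^2)^2)"
      using growth[of "2*n"] that psd[of "x^2"] by (intro mult_right_mono) linarith+
    finally show ?thesis
      by (simp add: s_def power_mult_distrib mult_ac flip: power_mult)
  qed
  have "s 1 \<le> r * s 0"
  proof (rule ccontr)
    assume c: "\<not> s 1 \<le> r * s 0"
    have p0: "0 < s 0"
    proof (rule ccontr)
      assume "\<not> 0 < s 0"
      then have "s 0 = 0" using s0[of 0] by simp
      then have "(s 1)^2 \<le> 0" using logconvex[of 0] by simp
      then have "s 1 = 0" by simp
      with c \<open>s 0 = 0\<close> show False by simp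
    qed
    define q where "q = s 1 / s 0"
    have qr: "r < q" using c p0 by (simp add: q_def field_simps)
    have step: "0 < s n \<and> q * s n \<le> s (Suc n)" for n
    proof (induction n)
      case 0
      then show ?case using p0 by (simp add: q_def)
    next
      case (Suc n)
      have pos: "0 < s (Suc n)"
        using Suc qr r mult_pos_pos[of q "s n"] by linarith
      have "q * s n * s (Suc n) \<le> s (Suc n) * s (Suc n)"
        using Suc pos by (intro mult_right_mono) auto
      also have "\<dots> \<le> s n * s (Suc (Suc n))"
        using logconvex[of n] by (simp add: power2_eq_square)
      finally have "s n * (q * s (Suc n)) \<le> s n * s (Suc (Suc n))"
        by (simp add: mult_ac)
      then show ?case using Suc pos by simp
    qed
    have lower: "q^n * s 0 \<le> s n" for n
    proof (induction n)
      case (Suc n)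
      have "q ^ Suc n * s 0 = q * (q^n * s 0)" by simp
      also have "\<dots> \<le> q * s n" using Suc qr r by (intro mult_left_mono) auto
      also have "\<dots> \<le> s (Suc n)" using step by blast
      finally show ?case .
    qed simp
    have both: "(s 0)^2 * (q^2)^n \<le> (M * l ((x^2)^2)) * (r^2)^n" if "1 \<le> n" for n
    proof -
      have "(q^n * s 0)^2 \<le> (s n)^2"
        using lower[of n] p0 qr r by (intro power_mono) auto
      also note upper[OF that]
      finally show ?thesis by (simp add: power_mult_distrib mult_ac flip: power_mult)
    qed
    show False
    proof (cases "r = 0")
      case True
      then show False using both[of 1] p0 qr by (simp add: mult_le_0_iff)
    next
      case False
      then have rp: "0 < r" using r by simp
      have gt: "1 < (q/r)^2" using qr rp by (intro one_less_power) (auto simp: field_simps)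
      define N where "N = M * l ((x^2)^2)"
      obtain n where n: "N / (s 0)^2 < ((q/r)^2)^n"
        using real_arch_pow[OF gt] by blast
      have "1 \<le> max 1 n" by simp
      then obtain m where m: "1 \<le> m" "n \<le> m" by (meson max.cobounded2)
      have "((q/r)^2)^n \<le> ((q/r)^2)^m" using gt m by (intro power_increasing) auto
      with n have "N / (s 0)^2 < ((q/r)^2)^m" by linarith
      then have "N / (s 0)^2 < (q^2)^m / (r^2)^m" by (simp only: power_divide)
      moreover have "0 < (r^2)^m" "0 < (s 0)^2" using rp p0 by auto
      moreover have "P * R < S * Q" if "P / S < Q / R" "0 < R" "0 < S" for P Q R S :: real
        using that by (simp add: field_simps)
      ultimately have "N * (r^2)^m < (s 0)^2 * (q^2)^m" by blast
      then show False using leD[OF both[OF m(1)]] unfolding N_def by blast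
    qed
  qed
  moreover have "s 1 = l (b^2 * x^2)" "s 0 = l (x^2)"
    by (simp_all add: s_def power_mult_distrib)
  ultimately show ?thesis by simp
qed

section \<open>Extreme points of compact sets of functions\<close>

text \<open>
  Pointwise convergence is a Hausdorff topology, whatever the index type. The intermediate separation
  classes are instantiated first so that their arities stay coherent with the metric on functions
  over a countable type.
\<close>

instance "fun" :: (type, t0_space) t0_space
proof
  fix f g :: "'a \<Rightarrow> 'b"
  assume "f \<noteq> g"
  then obtain i where "f i \<noteq> g i" by blast
  then obtain U where U: "open U" "f i \<in> U \<longleftrightarrow> g i \<notin> U"
    using t0_space_class.t0_space[OF \<open>f i \<noteq> g i\<close>] by blast
  have "open ((\<lambda>h::'a \<Rightarrow> 'b. h i) -` U)"
    using U by (intro open_vimage) auto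
  then show "\<exists>U. open U \<and> \<not> (f \<in> U \<longleftrightarrow> g \<in> U)"
    using U by (intro exI[of _ "(\<lambda>h. h i) -` U"]) auto
qed

instance "fun" :: (type, t1_space) t1_space
proof
  fix f g :: "'a \<Rightarrow> 'b"
  assume "f \<noteq> g"
  then obtain i where "f i \<noteq> g i" by blast
  then obtain U where U: "open U" "f i \<in> U" "g i \<notin> U"
    using t1_space_class.t1_space[OF \<open>f i \<noteq> g i\<close>] by blast
  have "open ((\<lambda>h::'a \<Rightarrow> 'b. h i) -` U)"
    using U by (intro open_vimage) auto
  then show "\<exists>U. open U \<and> f \<in> U \<and> g \<notin> U"
    using U by (intro exI[of _ "(\<lambda>h. h i) -` U"]) auto
qed

instance "fun" :: (type, t2_space) t2_space
proof
  fix f g :: "'a \<Rightarrow> 'b"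
  assume "f \<noteq> g"
  then obtain i where "f i \<noteq> g i" by blast
  then obtain U V where UV: "open U" "open V" "f i \<in> U" "g i \<in> V" "U \<inter> V = {}"
    using hausdorff[OF \<open>f i \<noteq> g i\<close>] by blast
  have "open ((\<lambda>h::'a \<Rightarrow> 'b. h i) -` U)" "open ((\<lambda>h::'a \<Rightarrow> 'b. h i) -` V)"
    using UV by (auto intro!: open_vimage)
  then show "\<exists>U V. open U \<and> open V \<and> f \<in> U \<and> g \<in> V \<and> U \<inter> V = {}"
    using UV(3-5) by (intro exI[of _ "(\<lambda>h. h i) -` U"] exI[of _ "(\<lambda>h. h i) -` V"]) auto
qed

text \<open>
  For a singleton \<open>F = {e}\<close> this says that \<open>e\<close> is an extreme point of \<open>K\<close>.
\<close>

definition convex_face :: "('i \<Rightarrow> real) set \<Rightarrow> ('i \<Rightarrow> real) set \<Rightarrow> bool" where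
  "convex_face F K \<longleftrightarrow> F \<subseteq> K \<and>
     (\<forall>u\<in>K. \<forall>v\<in>K. \<forall>t. 0 < t \<and> t < 1 \<and> (\<lambda>i. (1 - t) * u i + t * v i) \<in> F \<longrightarrow> u \<in> F \<and> v \<in> F)"

text \<open>
  If a convex combination minimises the value at \<open>b\<close> over a face, both of its end points lie in the face,
  and neither can lie below the minimum.
\<close>

lemma convex_face_argmin:
  assumes "convex_face F K"
  shows "convex_face {l \<in> F. \<forall>m\<in>F. l b \<le> m b} K"
  unfolding convex_face_def
proof (intro conjI ballI allI impI)
  show "{l \<in> F. \<forall>m\<in>F. l b \<le> m b} \<subseteq> K" using assms by (auto simp: convex_face_def)
next
  fix u v t
  assume uv: "u \<in> K" "v \<in> K"
    and t: "0 < t \<and> t < 1 \<and> (\<lambda>i. (1 - t) * u i + t * v i) \<in> {l \<in> F. \<forall>m\<in>F. l b \<le> m b}"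
  then have F: "u \<in> F" "v \<in> F" and min: "\<And>m. m \<in> F \<Longrightarrow> (1 - t) * u b + t * v b \<le> m b"
    using assms by (auto simp: convex_face_def)
  have "t * v b \<le> t * u b" "(1 - t) * u b \<le> (1 - t) * v b"
    using min[OF F(1)] min[OF F(2)] by (simp_all add: algebra_simps)
  then have "v b \<le> u b" "u b \<le> v b" using t by simp_all
  then have "u b = v b" by simp
  then have "u b \<le> m b" "v b \<le> m b" if "m \<in> F" for m
    using min[OF that] by (simp_all add: algebra_simps)
  then show "u \<in> {l \<in> F. \<forall>m\<in>F. l b \<le> m b}" "v \<in> {l \<in> F. \<forall>m\<in>F. l b \<le> m b}"
    using F by auto
qed

lemma closed_argmin:
  fixes F :: "('i \<Rightarrow> real) set"
  assumes "closed F"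
  shows "closed {l \<in> F. \<forall>m\<in>F. l b \<le> m b}"
proof -
  have "closed {l::'i \<Rightarrow> real. l b \<le> c}" for c
    by (intro closed_Collect_le continuous_intros) simp
  then have "closed (F \<inter> (\<Inter>m\<in>F. {l. l b \<le> m b}))"
    using assms by blast
  moreover have "F \<inter> (\<Inter>m\<in>F. {l. l b \<le> m b}) = {l \<in> F. \<forall>m\<in>F. l b \<le> m b}" by auto
  ultimately show ?thesis by simp
qed

lemma argmin_nonempty:
  fixes F :: "('i \<Rightarrow> real) set"
  assumes "compact F" "F \<noteq> {}"
  shows "{l \<in> F. \<forall>m\<in>F. l b \<le> m b} \<noteq> {}"
proof -
  have "continuous_on F (\<lambda>l. l b)"
    by (rule continuous_on_subset[OF continuous_on_product_coordinates]) simp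
  then show ?thesis using continuous_attains_inf[OF assms] by auto
qed

text \<open>
  Zorn's lemma for reverse inclusion, applied to complements: the intersection of a chain of nonempty closed
  faces is a closed face, and compactness keeps it nonempty.
\<close>

lemma compact_minimal_face:
  fixes K F0 :: "('i \<Rightarrow> real) set"
  assumes K: "compact K" and F0: "F0 \<noteq> {}" "closed F0" "convex_face F0 K"
  obtains F where "F \<subseteq> F0" "F \<noteq> {}" "closed F" "convex_face F K"
    "\<And>G. G \<subseteq> F \<Longrightarrow> G \<noteq> {} \<Longrightarrow> closed G \<Longrightarrow> convex_face G K \<Longrightarrow> G = F"
proof -
  define \<F> where "\<F> = {F. F \<subseteq> F0 \<and> F \<noteq> {} \<and> closed F \<and> convex_face F K}"
  have "\<exists>M\<in>uminus ` \<F>. \<forall>X\<in>uminus ` \<F>. M \<subseteq> X \<longrightarrow> X = M"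
  proof (rule subset_Zorn_nonempty)
    show "uminus ` \<F> \<noteq> {}" using F0 by (auto simp: \<F>_def)
  next
    fix \<C> assume C: "\<C> \<noteq> {}" "subset.chain (uminus ` \<F>) \<C>"
    define \<D> where "\<D> = uminus ` \<C>"
    have D: "\<D> \<noteq> {}" "\<D> \<subseteq> \<F>" "\<And>X Y. X \<in> \<D> \<Longrightarrow> Y \<in> \<D> \<Longrightarrow> X \<subseteq> Y \<or> Y \<subseteq> X"
      using C by (auto simp: \<D>_def subset_chain_def)
    have sub: "\<And>X. X \<in> \<D> \<Longrightarrow> X \<subseteq> F0" and ne: "{} \<notin> \<D>"
      and cl: "\<And>X. X \<in> \<D> \<Longrightarrow> closed X" and fc: "\<And>X. X \<in> \<D> \<Longrightarrow> convex_face X K"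
      using D(2) by (auto simp: \<F>_def)
    have "K \<inter> \<Inter>\<D> \<noteq> {}"
    proof (rule compact_imp_fip[OF K cl])
      fix B assume B: "finite B" "B \<subseteq> \<D>"
      show "K \<inter> \<Inter>B \<noteq> {}"
      proof (cases "B = {}")
        case True
        then show ?thesis using F0 by (auto simp: convex_face_def)
      next
        case False
        have "\<Inter>B \<in> B"
          by (rule Inter_in_chain[of _ UNIV]) (use B False D(3) in \<open>auto simp: subset_chain_def\<close>)
        then have "\<Inter>B \<in> \<D>" using B by blast
        then have "\<Inter>B \<subseteq> K" "\<Inter>B \<noteq> {}" using fc[of "\<Inter>B"] ne unfolding convex_face_def by metis+
        then show ?thesis by blast
      qed
    qed
    moreover have "\<Inter>\<D> \<subseteq> F0" using D(1) sub by blast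
    moreover have "closed (\<Inter>\<D>)" using cl by blast
    moreover have "convex_face (\<Inter>\<D>) K"
      unfolding convex_face_def
    proof (intro conjI ballI allI impI)
      show "\<Inter>\<D> \<subseteq> K" using D(1) fc by (auto simp: convex_face_def)
    next
      fix u v t
      assume uv: "u \<in> K" "v \<in> K"
        and t: "0 < t \<and> t < 1 \<and> (\<lambda>i. (1 - t) * u i + t * v i) \<in> \<Inter>\<D>"
      have "u \<in> X \<and> v \<in> X" if X: "X \<in> \<D>" for X
      proof -
        have "(\<lambda>i. (1 - t) * u i + t * v i) \<in> X" using t X by blast
        then show ?thesis using fc[OF X] uv t unfolding convex_face_def by blast
      qed
      then show "u \<in> \<Inter>\<D>" "v \<in> \<Inter>\<D>" by blast+
    qed
    ultimately have "\<Inter>\<D> \<in> \<F>" by (auto simp: \<F>_def)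
    moreover have "\<Union>\<C> = - \<Inter>\<D>" by (auto simp: \<D>_def)
    ultimately show "\<Union>\<C> \<in> uminus ` \<F>" by blast
  qed
  then obtain F where F: "F \<in> \<F>" "\<forall>X\<in>uminus ` \<F>. - F \<subseteq> X \<longrightarrow> X = - F"
    by (elim bexE imageE) simp
  show thesis
  proof (rule that)
    show "F \<subseteq> F0" "F \<noteq> {}" "closed F" "convex_face F K" using F(1) by (auto simp: \<F>_def)
    fix G assume G: "G \<subseteq> F" "G \<noteq> {}" "closed G" "convex_face G K"
    then have "G \<in> \<F>" using \<open>F \<subseteq> F0\<close> by (auto simp: \<F>_def)
    then have "- G = - F" using F(2) G(1) by (metis Compl_subset_Compl_iff imageI)
    then show "G = F" by simp
  qed
qed

text \<open>
  The part of the Krein--Milman theorem used below. Inside the face where the value at \<open>a\<close> is minimal, take a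
  minimal closed face. Minimising any other coordinate over it gives a smaller face, so every coordinate is
  constant on it and it consists of one point.
\<close>

lemma extreme_minimizer_exists:
  fixes K :: "('i \<Rightarrow> real) set"
  assumes K: "compact K" "K \<noteq> {}"
  obtains e where "e \<in> K" "convex_face {e} K" "\<And>l. l \<in> K \<Longrightarrow> e a \<le> l a"
proof -
  define F0 where "F0 = {l \<in> K. \<forall>m\<in>K. l a \<le> m a}"
  have "convex_face K K" by (auto simp: convex_face_def)
  then have F0: "F0 \<noteq> {}" "closed F0" "convex_face F0 K"
    unfolding F0_def
    using argmin_nonempty[OF K] closed_argmin[OF compact_imp_closed[OF K(1)]] convex_face_argmin[of K K]
    by blast+
  obtain F where F: "F \<subseteq> F0" "F \<noteq> {}" "closed F" "convex_face F K"
    and min: "\<And>G. G \<subseteq> F \<Longrightarrow> G \<noteq> {} \<Longrightarrow> closed G \<Longrightarrow> convex_face G K \<Longrightarrow> G = F"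
    by (rule compact_minimal_face[OF K(1) F0]) (rule that)
  have cF: "compact F"
    using compact_Int_closed[OF K(1) F(3)] F(4) by (simp add: convex_face_def Int_absorb1)
  have eq: "{l \<in> F. \<forall>m\<in>F. l b \<le> m b} = F" for b
    by (intro min argmin_nonempty closed_argmin convex_face_argmin F cF) blast
  obtain e where e: "e \<in> F" using F by blast
  have "F = {e}"
  proof -
    have "l = e" if "l \<in> F" for l
    proof
      fix b
      have "l \<in> {l \<in> F. \<forall>m\<in>F. l b \<le> m b}" "e \<in> {l \<in> F. \<forall>m\<in>F. l b \<le> m b}"
        unfolding eq using that e by blast+
      then show "l b = e b" using that e by (simp add: order_antisym)
    qed
    then show ?thesis using e by blast
  qed
  then show thesis using that[of e] F e by (auto simp: F0_def)
qed

section \<open>Extreme states are characters\<close>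

text \<open>
  The last condition says that multiplication by \<open>b\<close> has norm at most \<open>\<bar>p b\<bar>\<close> on the pre-Hilbert space with
  inner product \<open>l (x * y)\<close>.
\<close>

definition states :: "('a::{comm_ring_1, real_algebra_1} \<Rightarrow> real) \<Rightarrow> ('a \<Rightarrow> real) set" where
  "states p = {l. linear l \<and> l 1 = 1 \<and> (\<forall>x. 0 \<le> l (x^2)) \<and> (\<forall>b x. l (b^2 * x^2) \<le> (p b)^2 * l (x^2))}"

lemma statesD:
  assumes "l \<in> states p"
  shows "linear l" "l 1 = 1" "0 \<le> l (x^2)" "l (b^2 * x^2) \<le> (p b)^2 * l (x^2)"
  using assms by (auto simp: states_def)

lemma states_growth:
  assumes "l \<in> states p"
  shows "l (b^(2*n)) \<le> ((p b)^2)^n"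
proof (induction n)
  case 0
  then show ?case using statesD(2)[OF assms] by simp
next
  case (Suc n)
  have "l (b^(2*Suc n)) = l (b^2 * (b^n)^2)"
    by (simp flip: power_mult power_add add: mult.commute)
  also have "\<dots> \<le> (p b)^2 * l ((b^n)^2)" by (rule statesD(4)[OF assms])
  also have "(b^n)^2 = b^(2*n)" by (metis power_mult mult.commute)
  also have "(p b)^2 * l (b^(2*n)) \<le> (p b)^2 * ((p b)^2)^n"
    by (intro mult_left_mono Suc) simp
  finally show ?case by simp
qed

lemma states_bound:
  assumes "l \<in> states p"
  shows "\<bar>l b\<bar> \<le> \<bar>p b\<bar>"
proof -
  have "(l (b * 1))^2 \<le> l (b^2) * l (1^2)"
    by (rule psd_Cauchy_Schwarz) (use statesD[OF assms] in auto)
  also have "\<dots> \<le> (p b)^2"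
    using states_growth[OF assms, of b 1] statesD(2)[OF assms] by simp
  finally show ?thesis using abs_le_square_iff by auto
qed

text \<open>
  It suffices to bound the even moments up to an arbitrary factor. This is what makes the set of states
  stable under tilting in the next lemmas, where such factors appear.
\<close>

lemma statesI:
  assumes "linear l" "l 1 = 1" "\<And>x. 0 \<le> l (x^2)"
    and "\<And>b. \<exists>M. \<forall>n\<ge>1. l (b^(2*n)) \<le> M * ((p b)^2)^n"
  shows "l \<in> states p"
proof -
  have "l (b^2 * x^2) \<le> (p b)^2 * l (x^2)" for b x
  proof -
    obtain M where "\<And>n. 1 \<le> n \<Longrightarrow> l (b^(2*n)) \<le> M * ((p b)^2)^n" using assms(4) by blast
    then show ?thesis by (intro psd_growth_bound[OF assms(1,3)]) auto
  qed
  then show ?thesis using assms by (auto simp: states_def)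
qed

lemma closed_linear_functionals: "closed {l :: 'a::real_vector \<Rightarrow> real. linear l}"
proof -
  have "closed {l::'a \<Rightarrow> real. (\<forall>x y. l (x + y) = l x + l y) \<and> (\<forall>r x. l (r *\<^sub>R x) = r * l x)}"
    by (intro closed_Collect_all closed_Collect_conj closed_Collect_eq continuous_intros; simp)
  then show ?thesis by (simp add: linear_iff)
qed

lemma compact_box: "compact {l :: 'i \<Rightarrow> real. \<forall>b. \<bar>l b\<bar> \<le> q b}"
proof -
  have "compactin (product_topology (\<lambda>_::'i. euclideanreal) UNIV) (Pi\<^sub>E UNIV (\<lambda>b. {- q b..q b}))"
    by (simp add: compactin_PiE)
  then have "compact (Pi\<^sub>E UNIV (\<lambda>b. {- q b..q b}))"
    by (simp add: euclidean_product_topology)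
  moreover have "Pi\<^sub>E UNIV (\<lambda>b. {- q b..q b}) = {l. \<forall>b. \<bar>l b\<bar> \<le> q b}"
    by (auto simp: PiE_UNIV_domain abs_le_iff minus_le_iff)
  ultimately show ?thesis by simp
qed

lemma compact_states: "compact (states p)"
proof -
  have "closed {l :: 'a \<Rightarrow> real. linear l \<and> l 1 = 1 \<and> (\<forall>x. 0 \<le> l (x^2)) \<and>
                  (\<forall>b x. l (b^2 * x^2) \<le> (p b)^2 * l (x^2))}"
    by (intro closed_Collect_conj closed_linear_functionals closed_Collect_all closed_Collect_eq
          closed_Collect_le continuous_intros; simp)
  then have "closed (states p)" by (simp add: states_def)
  then have "compact ({l. \<forall>b. \<bar>l b\<bar> \<le> \<bar>p b\<bar>} \<inter> states p)"
    by (rule compact_Int_closed[OF compact_box])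
  moreover have "{l. \<forall>b. \<bar>l b\<bar> \<le> \<bar>p b\<bar>} \<inter> states p = states p"
    using states_bound by blast
  ultimately show ?thesis by simp
qed

text \<open>
  Here \<open>b\<close> acts as an operator of norm at most 1/2, so \<open>1 + b\<close> acts as a positive operator between 1/2
  and 3/2. Hence \<open>x \<mapsto> e ((1 + b) x)\<close> is positive on squares and its moments exceed those of \<open>e\<close> by at most
  a constant factor.
\<close>

lemma tilted_state:
  assumes e: "e \<in> states p" and b: "\<And>x. e (b^2 * x^2) \<le> e (x^2) / 4"
  shows "\<bar>e b\<bar> \<le> 1/2" "(\<lambda>x. e ((1 + b) * x) / (1 + e b)) \<in> states p"
proof -
  note sD = statesD[OF e]
  interpret linear e by (rule sD(1))
  have half: "\<bar>e (b * x^2)\<bar> \<le> e (x^2) / 2" for x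
  proof -
    have "(e ((b * x) * x))^2 \<le> e ((b * x)^2) * e (x^2)"
      by (rule psd_Cauchy_Schwarz) (use sD in auto)
    also have "\<dots> \<le> e (x^2) / 4 * e (x^2)"
      using b[of x] sD(3) by (intro mult_right_mono) (auto simp: power_mult_distrib)
    also have "\<dots> = (e (x^2) / 2)^2" by (simp add: power2_eq_square)
    finally have "\<bar>e ((b * x) * x)\<bar> \<le> \<bar>e (x^2) / 2\<bar>" by (simp only: abs_le_square_iff)
    then show ?thesis using sD(3)[of x] by (simp add: power2_eq_square mult_ac)
  qed
  show eb: "\<bar>e b\<bar> \<le> 1/2" using half[of 1] sD(2) by simp
  then have pos: "1/2 \<le> 1 + e b" by linarith
  show "(\<lambda>x. e ((1 + b) * x) / (1 + e b)) \<in> states p"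
  proof (rule statesI)
    show "linear (\<lambda>x. e ((1 + b) * x) / (1 + e b))"
      by (rule linearI) (simp_all add: algebra_simps add scale add_divide_distrib)
    show "e ((1 + b) * 1) / (1 + e b) = 1" using pos by (simp add: add sD(2))
    show "0 \<le> e ((1 + b) * x^2) / (1 + e b)" for x
      using pos half[of x] sD(3)[of x] by (simp add: algebra_simps add)
    show "\<exists>M. \<forall>n\<ge>1. e ((1 + b) * c^(2*n)) / (1 + e b) \<le> M * ((p c)^2)^n" for c
    proof (intro exI allI impI)
      fix n :: nat
      have sq: "c^(2*n) = (c^n)^2" by (metis power_mult mult.commute)
      have nn: "0 \<le> e (c^(2*n))" unfolding sq by (rule sD(3))
      have "e ((1 + b) * c^(2*n)) \<le> 3/2 * e (c^(2*n))"
        using half[of "c^n"] unfolding sq by (simp add: algebra_simps add)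
      also have "\<dots> \<le> 3 * (1 + e b) * e (c^(2*n))"
        using pos nn by (intro mult_right_mono) auto
      also have "\<dots> \<le> 3 * (1 + e b) * ((p c)^2)^n"
        using pos states_growth[OF e] by (intro mult_left_mono) auto
      finally show "e ((1 + b) * c^(2*n)) / (1 + e b) \<le> 3 * ((p c)^2)^n"
        using pos by (simp add: field_simps)
    qed
  qed
qed

text \<open>
  For small \<open>b\<close>, the state \<open>e\<close> is a convex combination of its tilts by \<open>1 + b\<close> and by \<open>1 - b\<close>. Extremality
  makes the tilt by \<open>1 + b\<close> equal to \<open>e\<close>, which reads \<open>e (b x) = e b e x\<close>. The general case follows by scaling.
\<close>

lemma extreme_state_multiplicative:
  assumes e: "e \<in> states p" and ext: "convex_face {e} (states p)"
  shows "e (b * x) = e b * e x"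
proof -
  note sD = statesD[OF e]
  interpret linear e by (rule sD(1))
  have small: "e (b * x) = e b * e x" if b: "\<And>x. e (b^2 * x^2) \<le> e (x^2) / 4" for b
  proof -
    define u where "u = (\<lambda>x. e ((1 + b) * x) / (1 + e b))"
    define v where "v = (\<lambda>x. e ((1 + - b) * x) / (1 + e (- b)))"
    \<comment> \<open>the two tilts have masses \<open>1 + e b\<close> and \<open>1 - e b\<close>, which add up to 2\<close>
    define t where "t = (1 - e b) / 2"
    have eb: "\<bar>e b\<bar> \<le> 1/2" and u: "u \<in> states p"
      using tilted_state[OF e b] by (simp_all add: u_def)
    have v: "v \<in> states p"
      using tilted_state(2)[OF e, of "- b"] b by (simp add: v_def)
    have t: "0 < t" "t < 1" using eb by (auto simp: t_def)
    have "(1 - t) * u y + t * v y = e y" for y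
    proof -
      have "(1 - t) * u y = e ((1 + b) * y) / 2"
        using eb by (simp add: t_def u_def field_simps)
      moreover have "t * v y = e ((1 + - b) * y) / 2"
        using eb by (simp add: t_def v_def neg field_simps)
      moreover have "e ((1 + b) * y) + e ((1 + - b) * y) = 2 * e y"
        by (simp add: algebra_simps add diff)
      ultimately show ?thesis by simp
    qed
    then have "(\<lambda>y. (1 - t) * u y + t * v y) \<in> {e}" by auto
    then have "u = e"
      using ext u v t unfolding convex_face_def by blast
    then have "u x = e x" by simp
    then show ?thesis using eb by (simp add: u_def field_simps add)
  qed
  \<comment> \<open>scaling by \<open>s\<close> brings the norm of \<open>b\<close> down to at most 1/2\<close>
  define s where "s = 1 / (2 * (1 + \<bar>p b\<bar>))"
  have s: "0 < s" "(s * p b)^2 \<le> 1/4"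
  proof -
    show "0 < s" by (simp add: s_def add_pos_nonneg)
    have "\<bar>s * p b\<bar> \<le> \<bar>1/2\<bar>" by (simp add: s_def abs_mult field_simps)
    then have "(s * p b)^2 \<le> (1/2)^2" by (simp only: abs_le_square_iff)
    then show "(s * p b)^2 \<le> 1/4" by (simp add: power2_eq_square)
  qed
  have "e ((s *\<^sub>R b)^2 * y^2) \<le> e (y^2) / 4" for y
  proof -
    have "e ((s *\<^sub>R b)^2 * y^2) = s^2 * e (b^2 * y^2)"
      by (simp add: power2_eq_square scale flip: scaleR_scaleR)
    also have "\<dots> \<le> s^2 * ((p b)^2 * e (y^2))"
      by (intro mult_left_mono sD(4)) simp
    also have "\<dots> = (s * p b)^2 * e (y^2)" by (simp add: power_mult_distrib)
    also have "\<dots> \<le> 1/4 * e (y^2)" using s sD(3) by (intro mult_right_mono)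
    finally show ?thesis by simp
  qed
  from small[OF this] show ?thesis using s by (simp add: scale)
qed

definition bounded_characters :: "('a::{comm_ring_1, real_algebra_1} \<Rightarrow> real) \<Rightarrow> ('a \<Rightarrow> real) set" where
  "bounded_characters p = {\<alpha> \<in> characters. \<forall>a. \<bar>\<alpha> a\<bar> \<le> \<bar>p a\<bar>}"

text \<open>
  The evaluation at \<open>a\<close> attains its minimum over the states at an extreme point, which is a character in the
  given set.
\<close>

lemma state_nonneg:
  assumes L: "L \<in> states p" and a: "\<And>\<alpha>. \<alpha> \<in> bounded_characters p \<Longrightarrow> 0 \<le> \<alpha> a"
  shows "0 \<le> L a"
proof -
  obtain e where e: "e \<in> states p" "convex_face {e} (states p)" "e a \<le> L a"
    using extreme_minimizer_exists[OF compact_states, of p a] L by (metis empty_iff)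
  have "e \<in> bounded_characters p"
    using statesD[OF e(1)] states_bound[OF e(1)] extreme_state_multiplicative[OF e(1,2)]
    by (auto simp: bounded_characters_def characters_def)
  then show ?thesis using a e(3) by fastforce
qed

lemma closed_characters: "closed (characters :: ('a::{comm_ring_1, real_algebra_1} \<Rightarrow> real) set)"
  unfolding characters_def
  by (intro closed_Collect_conj closed_linear_functionals closed_Collect_all closed_Collect_eq
          continuous_intros; simp)

lemma compact_bounded_characters: "compact (bounded_characters p)"
proof -
  have "bounded_characters p = {l. \<forall>b. \<bar>l b\<bar> \<le> \<bar>p b\<bar>} \<inter> characters"
    by (auto simp: bounded_characters_def)
  then show ?thesis using compact_Int_closed[OF compact_box closed_characters] by metis
qed

section \<open>Riesz representation on a compact Hausdorff space\<close>

text \<open>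
  The functional is defined on an algebra of continuous functions that separates points and contains the
  constants, not on all continuous functions. Approximate separation of closed sets by members of the
  algebra (\<open>two\<close>) replaces Urysohn functions throughout. Only the values on \<open>S\<close> of members of the algebra matter.
\<close>

locale positive_functional_on = function_ring_on R S
  for R :: "('x::t2_space \<Rightarrow> real) set" and S +
  fixes \<Lambda> :: "('x \<Rightarrow> real) \<Rightarrow> real"
  assumes \<Lambda>_add: "f \<in> R \<Longrightarrow> g \<in> R \<Longrightarrow> \<Lambda> (\<lambda>x. f x + g x) = \<Lambda> f + \<Lambda> g"
    and \<Lambda>_scale: "f \<in> R \<Longrightarrow> \<Lambda> (\<lambda>x. c * f x) = c * \<Lambda> f"
    and \<Lambda>_nonneg: "f \<in> R \<Longrightarrow> (\<And>x. x \<in> S \<Longrightarrow> 0 \<le> f x) \<Longrightarrow> 0 \<le> \<Lambda> f"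
    and \<Lambda>_one: "\<Lambda> (\<lambda>_. 1) = 1"
begin

lemma scale: "f \<in> R \<Longrightarrow> (\<lambda>x. c * f x) \<in> R"
  using mult[OF const[of c]] by simp

lemma \<Lambda>_const: "\<Lambda> (\<lambda>_. c) = c"
  using \<Lambda>_scale[OF const[of 1], of c] \<Lambda>_one by simp

lemma \<Lambda>_diff:
  assumes "f \<in> R" "g \<in> R"
  shows "\<Lambda> (\<lambda>x. f x - g x) = \<Lambda> f - \<Lambda> g"
  using \<Lambda>_add[OF assms(1) scale[OF assms(2), of "-1"]] \<Lambda>_scale[OF assms(2), of "-1"] by simp

lemma \<Lambda>_mono:
  assumes "f \<in> R" "g \<in> R" "\<And>x. x \<in> S \<Longrightarrow> f x \<le> g x"
  shows "\<Lambda> f \<le> \<Lambda> g"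
  using \<Lambda>_nonneg[OF diff[OF assms(2,1)]] \<Lambda>_diff[OF assms(2,1)] assms(3) by simp

lemma \<Lambda>_sum:
  assumes "finite I" "\<And>i. i \<in> I \<Longrightarrow> f i \<in> R"
  shows "\<Lambda> (\<lambda>x. \<Sum>i\<in>I. f i x) = (\<Sum>i\<in>I. \<Lambda> (f i))"
  using assms
proof (induction I rule: finite_induct)
  case (insert i I)
  then show ?case using \<Lambda>_add[of "f i" "\<lambda>x. \<Sum>i\<in>I. f i x"] sum[of I f] by simp
qed (simp add: \<Lambda>_const)

definition dominators :: "'x set \<Rightarrow> ('x \<Rightarrow> real) set" where
  "dominators C = {f \<in> R. (\<forall>x\<in>S. 0 \<le> f x) \<and> (\<forall>x\<in>C. 1 \<le> f x)}"

text \<open>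
  On closed subsets of \<open>S\<close> this will be the measure of \<open>C\<close>. The set function is meant for closed \<open>C\<close> only;
  other sets are measured from inside later on.
\<close>

definition capacity :: "'x set \<Rightarrow> real" where
  "capacity C = (INF f\<in>dominators C. \<Lambda> f)"

lemma one_dominator: "(\<lambda>_. 1) \<in> dominators C"
  by (simp add: dominators_def const)

lemma \<Lambda>_dominator_bdd: "bdd_below (\<Lambda> ` dominators C)"
  by (rule bdd_belowI[of _ 0]) (auto simp: dominators_def intro: \<Lambda>_nonneg)

lemma capacity_le: "f \<in> dominators C \<Longrightarrow> capacity C \<le> \<Lambda> f"
  unfolding capacity_def by (rule cINF_lower[OF \<Lambda>_dominator_bdd])

lemma capacity_approx:
  assumes "0 < e"
  obtains f where "f \<in> dominators C" "\<Lambda> f < capacity C + e"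
proof -
  have "\<exists>f\<in>dominators C. \<Lambda> f < capacity C + e"
    using cINF_less_iff[OF _ \<Lambda>_dominator_bdd, of C "capacity C + e"] one_dominator assms
    unfolding capacity_def by fastforce
  then show thesis using that by blast
qed

text \<open>
  A function that dominates \<open>C\<close> only up to the factor \<open>c\<close> is still good for an upper bound. The
  approximations below produce such functions with \<open>c\<close> close to 1.
\<close>

lemma capacity_scaled_le:
  assumes "f \<in> R" "\<And>x. x \<in> S \<Longrightarrow> 0 \<le> f x" "\<And>x. x \<in> C \<Longrightarrow> c \<le> f x" "0 < c"
  shows "c * capacity C \<le> \<Lambda> f"
proof -
  have "(\<lambda>x. 1/c * f x) \<in> dominators C"
    using assms scale[OF assms(1), of "1/c"] by (auto simp: dominators_def)
  then have "capacity C \<le> 1/c * \<Lambda> f"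
    using capacity_le \<Lambda>_scale[OF assms(1)] by metis
  then show ?thesis using assms(4) by (simp add: field_simps)
qed

lemma capacity_nonneg: "0 \<le> capacity C"
  unfolding capacity_def
  by (rule cINF_greatest) (use one_dominator in \<open>auto simp: dominators_def intro: \<Lambda>_nonneg\<close>)

lemma capacity_le_1: "capacity C \<le> 1"
  using capacity_le[OF one_dominator] \<Lambda>_one by simp

lemma capacity_mono: "C \<subseteq> D \<Longrightarrow> capacity C \<le> capacity D"
  unfolding capacity_def
  by (rule cINF_superset_mono) (use one_dominator \<Lambda>_dominator_bdd in \<open>auto simp: dominators_def\<close>)

lemma capacity_empty: "capacity {} = 0"
proof -
  have "(\<lambda>_. 0) \<in> dominators {}" by (simp add: dominators_def const)
  then show ?thesis using capacity_le[of _ "{}"] \<Lambda>_const[of 0] capacity_nonneg[of "{}"] by fastforce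
qed

lemma capacity_whole: "capacity S = 1"
proof -
  have "1 \<le> capacity S"
    unfolding capacity_def
  proof (rule cINF_greatest)
    fix f assume "f \<in> dominators S"
    then show "1 \<le> \<Lambda> f" using \<Lambda>_mono[OF const[of 1], of f] \<Lambda>_one by (auto simp: dominators_def)
  qed (use one_dominator in blast)
  then show ?thesis using capacity_le_1[of S] by simp
qed

lemma capacity_subadditive:
  assumes "C \<subseteq> S" "D \<subseteq> S"
  shows "capacity (C \<union> D) \<le> capacity C + capacity D"
proof (rule field_le_epsilon)
  fix e :: real assume "0 < e"
  then have "0 < e/2" by simp
  obtain f where f: "f \<in> dominators C" "\<Lambda> f < capacity C + e/2" by (rule capacity_approx[OF \<open>0 < e/2\<close>])
  obtain g where g: "g \<in> dominators D" "\<Lambda> g < capacity D + e/2" by (rule capacity_approx[OF \<open>0 < e/2\<close>])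
  have "(\<lambda>x. f x + g x) \<in> dominators (C \<union> D)"
    unfolding dominators_def
  proof (intro CollectI conjI ballI)
    show "(\<lambda>x. f x + g x) \<in> R" using f g by (auto simp: dominators_def intro: add)
    fix x
    show "0 \<le> f x + g x" if "x \<in> S" using f g that by (auto simp: dominators_def)
    show "1 \<le> f x + g x" if "x \<in> C \<union> D"
    proof -
      have "0 \<le> f x" "0 \<le> g x" "1 \<le> f x \<or> 1 \<le> g x"
        using f g assms that by (auto simp: dominators_def)
      then show ?thesis by linarith
    qed
  qed
  from capacity_le[OF this] show "capacity (C \<union> D) \<le> capacity C + capacity D + e"
    using f g \<Lambda>_add[of f g] by (auto simp: dominators_def)
qed

lemma capacity_subadditive_finite:
  assumes "finite I" "\<And>i. i \<in> I \<Longrightarrow> C i \<subseteq> S"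
  shows "capacity (\<Union>i\<in>I. C i) \<le> (\<Sum>i\<in>I. capacity (C i))"
  using assms
proof (induction I rule: finite_induct)
  case (insert i I)
  have "capacity (C i \<union> (\<Union>i\<in>I. C i)) \<le> capacity (C i) + capacity (\<Union>i\<in>I. C i)"
    using insert.prems by (intro capacity_subadditive) auto
  then show ?case using insert by simp
qed (simp add: capacity_empty)

text \<open>
  Split a dominator \<open>f\<close> of the union as \<open>f u + f (1 - u)\<close>, where \<open>u\<close> is nearly 1 on \<open>C\<close> and nearly 0 on \<open>D\<close>.
\<close>

lemma capacity_superadditive:
  assumes C: "closed C" "C \<subseteq> S" and D: "closed D" "D \<subseteq> S" and disj: "C \<inter> D = {}"
  shows "capacity C + capacity D \<le> capacity (C \<union> D)"
proof (rule field_le_epsilon)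
  fix e0 :: real assume "0 < e0"
  define e where "e = min (e0/3) (1/2)"
  have e: "0 < e" "e < 1" "3 * e \<le> e0" using \<open>0 < e0\<close> by (auto simp: e_def)
  obtain f where f: "f \<in> dominators (C \<union> D)" "\<Lambda> f < capacity (C \<union> D) + e"
    by (rule capacity_approx[OF e(1)])
  then have fR: "f \<in> R" and f0: "\<And>x. x \<in> S \<Longrightarrow> 0 \<le> f x" and f1: "\<And>x. x \<in> C \<union> D \<Longrightarrow> 1 \<le> f x"
    by (auto simp: dominators_def)
  have "D \<inter> C = {}" using disj by blast
  from two[OF D C this e(1,2)]
  obtain u where uR: "u \<in> R" and "u ` S \<subseteq> {0..1}" "\<forall>x\<in>D. u x < e" "\<forall>x\<in>C. 1 - e < u x"
    by blast
  then have u: "u \<in> R" "\<And>x. x \<in> S \<Longrightarrow> 0 \<le> u x \<and> u x \<le> 1"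
      "\<And>x. x \<in> D \<Longrightarrow> u x < e" "\<And>x. x \<in> C \<Longrightarrow> 1 - e < u x"
    by (auto simp: image_subset_iff)
  have v: "(\<lambda>x. 1 - u x) \<in> R" by (rule diff[OF const u(1)])
  have "(1 - e) * capacity C \<le> \<Lambda> (\<lambda>x. f x * u x)"
  proof (rule capacity_scaled_le)
    show "1 - e \<le> f x * u x" if "x \<in> C" for x
      using mult_mono[of 1 "f x" "1 - e" "u x"] f1[of x] u(4)[OF that] that e by auto
  qed (use fR u f0 e in \<open>auto intro: mult\<close>)
  moreover have "(1 - e) * capacity D \<le> \<Lambda> (\<lambda>x. f x * (1 - u x))"
  proof (rule capacity_scaled_le)
    show "1 - e \<le> f x * (1 - u x)" if "x \<in> D" for x
      using mult_mono[of 1 "f x" "1 - e" "1 - u x"] f1[of x] u(3)[OF that] that e by auto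
  qed (use mult[OF fR v] u f0 e in auto)
  moreover have "\<Lambda> (\<lambda>x. f x * u x) + \<Lambda> (\<lambda>x. f x * (1 - u x)) = \<Lambda> f"
    using \<Lambda>_add[OF mult[OF fR u(1)] mult[OF fR v]] by (simp add: algebra_simps)
  ultimately have "capacity C + capacity D \<le> capacity (C \<union> D) + e + e * capacity C + e * capacity D"
    using f(2) by (simp add: algebra_simps)
  also have "\<dots> \<le> capacity (C \<union> D) + e + e * 1 + e * 1"
    using e capacity_le_1 by (intro add_mono mult_left_mono) auto
  finally show "capacity C + capacity D \<le> capacity (C \<union> D) + e0" using e by simp
qed

lemma S_closed: "closed S"
  by (rule compact_imp_closed[OF compact])

lemma closed_sublevel:
  assumes "f \<in> R" "closed D" "D \<subseteq> S"
  shows "closed {x \<in> D. f x \<le> c}" "closed {x \<in> D. c \<le> f x}"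
  by (rule continuous_on_closed_Collect_le; (rule continuous_on_const assms(2)
      continuous_on_subset[OF continuous[OF assms(1)] assms(3)]))+

text \<open>
  Let \<open>f\<close> be a nearly optimal dominator of \<open>C\<close>. The set \<open>E\<close> where \<open>f\<close> is noticeably below 1 is closed and
  misses \<open>C\<close>, and \<open>f\<close> together with a dominator of \<open>E\<close> dominates \<open>D\<close> up to a factor close to 1.
\<close>

lemma capacity_tight:
  assumes D: "closed D" "D \<subseteq> S" and C: "C \<subseteq> D" and "0 < e"
  obtains E where "closed E" "E \<subseteq> D - C" "capacity D \<le> capacity C + capacity E + e"
proof -
  define d where "d = min (e/3) (1/2)"
  have d: "0 < d" "d < 1" "3 * d \<le> e" using \<open>0 < e\<close> by (auto simp: d_def)
  obtain f where f: "f \<in> dominators C" "\<Lambda> f < capacity C + d" by (rule capacity_approx[OF d(1)])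
  define E where "E = {x \<in> D. f x \<le> 1 - d}"
  have E: "closed E" unfolding E_def
    by (rule closed_sublevel) (use f D in \<open>auto simp: dominators_def\<close>)
  obtain g where g: "g \<in> dominators E" "\<Lambda> g < capacity E + d" by (rule capacity_approx[OF d(1)])
  have "(1 - d) * capacity D \<le> \<Lambda> (\<lambda>x. f x + g x)"
  proof (rule capacity_scaled_le)
    show "1 - d \<le> f x + g x" if x: "x \<in> D" for x
    proof (cases "x \<in> E")
      case True
      then have "0 \<le> f x" "1 \<le> g x" using x f g D by (auto simp: dominators_def)
      then show ?thesis using d by simp
    next
      case False
      then have "1 - d \<le> f x" "0 \<le> g x" using x f g D by (auto simp: dominators_def E_def)
      then show ?thesis by simp
    qed
  qed (use f g d in \<open>auto simp: dominators_def intro: add\<close>)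
  also have "\<dots> = \<Lambda> f + \<Lambda> g" using f g by (intro \<Lambda>_add) (auto simp: dominators_def)
  finally have "capacity D \<le> capacity C + capacity E + 2 * d + d * capacity D"
    using f g by (simp add: algebra_simps)
  also have "\<dots> \<le> capacity C + capacity E + 2 * d + d * 1"
    using d capacity_le_1 by (intro add_mono mult_left_mono) auto
  also have "\<dots> \<le> capacity C + capacity E + e" using d by simp
  finally show thesis using that[of E] E f d by (force simp: E_def dominators_def)
qed

lemma capacity_supermodular:
  assumes C: "closed C" "C \<subseteq> S" and D: "closed D" "D \<subseteq> S"
  shows "capacity C + capacity D \<le> capacity (C \<union> D) + capacity (C \<inter> D)"
proof (rule field_le_epsilon)
  fix e :: real assume "0 < e"
  obtain E where E: "closed E" "E \<subseteq> C - C \<inter> D" "capacity C \<le> capacity (C \<inter> D) + capacity E + e"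
    by (rule capacity_tight[OF C _ \<open>0 < e\<close>, of "C \<inter> D"]) auto
  have "capacity E + capacity D \<le> capacity (E \<union> D)"
    using E C D by (intro capacity_superadditive) auto
  also have "\<dots> \<le> capacity (C \<union> D)" using E by (intro capacity_mono) auto
  finally show "capacity C + capacity D \<le> capacity (C \<union> D) + capacity (C \<inter> D) + e"
    using E by simp
qed

text \<open>
  Continuity along decreasing sequences, which is the source of countable additivity. A nearly optimal dominator of
  the intersection is close to 1 on some \<open>F n\<close> already, by compactness.
\<close>

lemma capacity_decreasing:
  fixes F :: "nat \<Rightarrow> 'x set"
  assumes F: "\<And>n. closed (F n)" "\<And>n. F n \<subseteq> S" "decseq F" and "0 < e"
  obtains n where "capacity (F n) < capacity (\<Inter>n. F n) + e"
proof -
  define d where "d = min (e/3) (1/2)"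
  have d: "0 < d" "d < 1" "3 * d \<le> e" using \<open>0 < e\<close> by (auto simp: d_def)
  obtain f where f: "f \<in> dominators (\<Inter>n. F n)" "\<Lambda> f < capacity (\<Inter>n. F n) + d"
    by (rule capacity_approx[OF d(1)])
  then have fR: "f \<in> R" by (simp add: dominators_def)
  have "\<exists>n. {x \<in> F n. f x \<le> 1 - d} = {}"
  proof (rule ccontr)
    assume "\<nexists>n. {x \<in> F n. f x \<le> 1 - d} = {}"
    then have ne: "{x \<in> F n. f x \<le> 1 - d} \<noteq> {}" for n by blast
    have "S \<inter> (\<Inter>n\<in>UNIV. {x \<in> F n. f x \<le> 1 - d}) \<noteq> {}"
    proof (rule compact_imp_fip_image[OF compact])
      show "closed {x \<in> F n. f x \<le> 1 - d}" for n by (rule closed_sublevel[OF fR F(1,2)])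
      fix I :: "nat set" assume "finite I"
      then obtain m where m: "\<forall>i\<in>I. i \<le> m" by (auto simp: finite_nat_set_iff_bounded_le)
      have "{x \<in> F m. f x \<le> 1 - d} \<subseteq> S \<inter> (\<Inter>n\<in>I. {x \<in> F n. f x \<le> 1 - d})"
        using m F(2,3) unfolding decseq_def by blast
      then show "S \<inter> (\<Inter>n\<in>I. {x \<in> F n. f x \<le> 1 - d}) \<noteq> {}" using ne[of m] by blast
    qed
    then obtain x where x: "x \<in> S \<inter> (\<Inter>n\<in>UNIV. {x \<in> F n. f x \<le> 1 - d})" by blast
    then have "x \<in> (\<Inter>n. F n)" "f x \<le> 1 - d" by auto
    moreover from this(1) have "1 \<le> f x" using f(1) by (simp only: dominators_def mem_Collect_eq)
    ultimately show False using d by linarith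
  qed
  then obtain n where n: "\<And>x. x \<in> F n \<Longrightarrow> 1 - d \<le> f x" by fastforce
  have "(1 - d) * capacity (F n) \<le> \<Lambda> f"
    by (rule capacity_scaled_le) (use f n d in \<open>auto simp: dominators_def\<close>)
  then have "capacity (F n) < capacity (\<Inter>n. F n) + d + d * capacity (F n)"
    using f(2) by (simp add: algebra_simps)
  also have "\<dots> \<le> capacity (\<Inter>n. F n) + d + d * 1"
    using d capacity_le_1 by (intro add_mono mult_left_mono) auto
  also have "\<dots> \<le> capacity (\<Inter>n. F n) + e" using d by simp
  finally show thesis using that by blast
qed

text \<open>
  These sets play the role of the measurable sets: a set and its complement can together be exhausted from
  inside by closed sets. The total capacity is 1, so a pair \<open>C\<close>, \<open>D\<close> misses at most \<open>e\<close>.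
\<close>

definition approximable :: "'x set \<Rightarrow> bool" where
  "approximable B \<longleftrightarrow> B \<subseteq> S \<and> (\<forall>e>0. \<exists>C D. closed C \<and> closed D \<and> C \<subseteq> B \<and> D \<subseteq> S - B \<and>
     1 - e < capacity C + capacity D)"

lemma approximable_closed:
  assumes "closed C" "C \<subseteq> S"
  shows "approximable C"
  unfolding approximable_def
proof (intro conjI allI impI)
  fix e :: real assume "0 < e"
  then have "0 < e/2" by simp
  obtain E where E: "closed E" "E \<subseteq> S - C" "capacity S \<le> capacity C + capacity E + e/2"
    by (rule capacity_tight[OF S_closed subset_refl assms(2) \<open>0 < e/2\<close>])
  have "1 - e < capacity C + capacity E" using E(3) capacity_whole \<open>0 < e\<close> by simp
  then show "\<exists>C' D. closed C' \<and> closed D \<and> C' \<subseteq> C \<and> D \<subseteq> S - C \<and> 1 - e < capacity C' + capacity D"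
    using E assms by blast
qed (rule assms)

lemma approximable_compl:
  assumes "approximable B"
  shows "approximable (S - B)"
  unfolding approximable_def
proof (intro conjI allI impI)
  fix e :: real assume "0 < e"
  then obtain C D where "closed C" "closed D" "C \<subseteq> B" "D \<subseteq> S - B" "1 - e < capacity C + capacity D"
    using assms unfolding approximable_def by blast
  moreover have "B \<subseteq> S" using assms by (simp add: approximable_def)
  ultimately show "\<exists>C D. closed C \<and> closed D \<and> C \<subseteq> S - B \<and> D \<subseteq> S - (S - B) \<and> 1 - e < capacity C + capacity D"
    by (intro exI[of _ D] exI[of _ C]) auto
qed auto

text \<open>
  In terms of the defects \<open>1 - capacity C - capacity D\<close>, the defect of the pair \<open>C1 \<union> C2\<close>, \<open>D1 \<inter> D2\<close> is at most the sum
  of the two given defects. This is supermodularity, applied to the \<open>C\<close>s and to the \<open>D\<close>s.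
\<close>

lemma capacity_pair_union:
  assumes C: "closed C1" "C1 \<subseteq> S" "closed C2" "C2 \<subseteq> S"
    and D: "closed D1" "D1 \<subseteq> S" "closed D2" "D2 \<subseteq> S"
    and disj: "C1 \<inter> D1 = {}" "C2 \<inter> D2 = {}"
  shows "capacity C1 + capacity D1 + (capacity C2 + capacity D2) - 1
           \<le> capacity (C1 \<union> C2) + capacity (D1 \<inter> D2)"
proof -
  have "capacity (C1 \<inter> C2) + capacity (D1 \<union> D2) \<le> capacity ((C1 \<inter> C2) \<union> (D1 \<union> D2))"
    using C D disj by (intro capacity_superadditive) auto
  also have "\<dots> \<le> 1" by (rule capacity_le_1)
  finally show ?thesis
    using capacity_supermodular[of C1 C2] capacity_supermodular[of D1 D2] C D by simp
qed

text \<open>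
  The common core of closure under countable unions and of countable subadditivity. Approximate \<open>A i\<close> with an
  error of order \<open>e / 2^i\<close>; the finite stages lose less than \<open>e/2\<close> in total, and passing from \<open>\<Inter>i\<le>n. D i\<close> to
  \<open>\<Inter>i. D i\<close> costs another \<open>e/2\<close> for large \<open>n\<close>.
\<close>

lemma approximable_sequence:
  fixes A :: "nat \<Rightarrow> 'x set"
  assumes A: "\<And>i. approximable (A i)" and e: "0 < e"
  obtains C D n where "\<And>i. closed (C i)" "\<And>i. C i \<subseteq> A i" "closed D" "D \<subseteq> S - (\<Union>i. A i)"
    "1 - e < capacity (\<Union>i\<le>(n::nat). C i) + capacity D"
proof -
  have "\<exists>C D. closed C \<and> closed D \<and> C \<subseteq> A i \<and> D \<subseteq> S - A i \<and> 1 - (e/2)/2^(i+1) < capacity C + capacity D" for i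
    using A[of i] e unfolding approximable_def by simp
  then obtain C D where cl: "\<And>i. closed (C i)" "\<And>i. closed (D i)"
    and sub: "\<And>i. C i \<subseteq> A i" "\<And>i. D i \<subseteq> S - A i"
    and large: "\<And>i. 1 - (e/2)/2^(i+1) < capacity (C i) + capacity (D i)"
    by metis
  have AS: "A i \<subseteq> S" for i using A by (auto simp: approximable_def)
  have CS: "C i \<subseteq> S" and DS: "D i \<subseteq> S" for i using sub[of i] AS[of i] by auto
  have disj: "C i \<inter> D i = {}" for i using sub[of i] by auto
  have finite_stage: "1 - e/2 < capacity (\<Union>i\<le>n. C i) + capacity (\<Inter>i\<le>n. D i)" for n
  proof -
    have "1 - (e/2) * (1 - 1/2^(n+1)) \<le> capacity (\<Union>i\<le>n. C i) + capacity (\<Inter>i\<le>n. D i)"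
    proof (induction n)
      case 0
      then show ?case using large[of 0] by simp
    next
      case (Suc n)
      have "capacity (\<Union>i\<le>n. C i) + capacity (\<Inter>i\<le>n. D i) + (capacity (C (Suc n)) + capacity (D (Suc n))) - 1
              \<le> capacity ((\<Union>i\<le>n. C i) \<union> C (Suc n)) + capacity ((\<Inter>i\<le>n. D i) \<inter> D (Suc n))"
      proof (rule capacity_pair_union)
        show "(\<Inter>i\<le>n. D i) \<subseteq> S" using DS[of 0] by blast
        show "(\<Union>i\<le>n. C i) \<inter> (\<Inter>i\<le>n. D i) = {}" using disj by blast
      qed (use cl CS DS disj in auto)
      moreover have "1 - (e/2)/2^(Suc n+1) < capacity (C (Suc n)) + capacity (D (Suc n))" by (rule large)
      moreover have "(e/2) * (1 - 1/2^(Suc n+1)) = (e/2) * (1 - 1/2^(n+1)) + (e/2)/2^(Suc n+1)"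
        by (simp add: field_simps)
      moreover have "1 - b' \<le> r" if "p + q - 1 \<le> r" "1 - a < q" "b' = b + a" "1 - b \<le> p"
        for a b b' p q r :: real using that by linarith
      ultimately have "1 - (e/2) * (1 - 1/2^(Suc n+1))
          \<le> capacity ((\<Union>i\<le>n. C i) \<union> C (Suc n)) + capacity ((\<Inter>i\<le>n. D i) \<inter> D (Suc n))"
        using Suc.IH by blast
      moreover have "(\<Union>i\<le>Suc n. C i) = (\<Union>i\<le>n. C i) \<union> C (Suc n)"
        "(\<Inter>i\<le>Suc n. D i) = (\<Inter>i\<le>n. D i) \<inter> D (Suc n)"
        by (auto simp: atMost_Suc)
      ultimately show ?case by (simp only:)
    qed
    moreover have "(e/2) * (1 - 1/2^(n+1)) < e/2" using e by (simp add: field_simps)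
    moreover have "1 - y < z" if "1 - x \<le> z" "x < y" for x y z :: real using that by linarith
    ultimately show ?thesis by blast
  qed
  define F where "F n = (\<Inter>i\<le>n. D i)" for n
  have "closed (F n)" "F n \<subseteq> S" for n
    using cl DS[of 0] by (auto simp: F_def)
  moreover have "decseq F" by (auto simp: F_def decseq_def)
  moreover have "0 < e/2" using e by simp
  ultimately obtain n where n: "capacity (F n) < capacity (\<Inter>n. F n) + e/2"
    by (rule capacity_decreasing) (rule that)
  have "(\<Inter>n. F n) = (\<Inter>i. D i)" by (auto simp: F_def)
  then have "1 - e < capacity (\<Union>i\<le>n. C i) + capacity (\<Inter>i. D i)"
    using n finite_stage[of n] unfolding F_def by simp
  moreover have "closed (\<Inter>i. D i)" using cl by auto
  moreover have "(\<Inter>i. D i) \<subseteq> S - (\<Union>i. A i)"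
  proof
    fix x assume x: "x \<in> (\<Inter>i. D i)"
    have "x \<in> S - A i" for i using sub(2)[of i] x by blast
    then show "x \<in> S - (\<Union>i. A i)" by blast
  qed
  ultimately show thesis using that[OF cl(1) sub(1)] by simp
qed

lemma approximable_Union:
  fixes A :: "nat \<Rightarrow> 'x set"
  assumes A: "\<And>i. approximable (A i)"
  shows "approximable (\<Union>i. A i)"
  unfolding approximable_def
proof (intro conjI allI impI)
  show "(\<Union>i. A i) \<subseteq> S" using A by (auto simp: approximable_def)
  fix e :: real assume e: "0 < e"
  obtain C D n where C: "\<And>i. closed (C i)" "\<And>i. C i \<subseteq> A i" and D: "closed D" "D \<subseteq> S - (\<Union>i. A i)"
    and "1 - e < capacity (\<Union>i\<le>(n::nat). C i) + capacity D"
    by (rule approximable_sequence[where A = A, OF A e]) (rule that)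
  moreover have "closed (\<Union>i\<le>n. C i)" "(\<Union>i\<le>n. C i) \<subseteq> (\<Union>i. A i)" using C by auto
  ultimately show "\<exists>C D. closed C \<and> closed D \<and> C \<subseteq> (\<Union>i. A i) \<and> D \<subseteq> S - (\<Union>i. A i) \<and> 1 - e < capacity C + capacity D"
    by blast
qed

lemma approximable_borel:
  assumes "B \<in> sets borel"
  shows "approximable (S \<inter> B)"
proof -
  have "B \<in> sigma_sets UNIV (Collect closed)"
    using assms by (simp add: borel_eq_closed)
  then show ?thesis
  proof (induction rule: sigma_sets.induct)
    case (Basic C)
    then show ?case using S_closed by (intro approximable_closed) auto
  next
    case Empty
    then show ?case by (intro approximable_closed) auto
  next
    case (Compl B)
    have "S \<inter> (UNIV - B) = S - S \<inter> B" by blast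
    then show ?case using approximable_compl[OF Compl.IH] by simp
  next
    case (Union A)
    have "S \<inter> (\<Union>i. A i) = (\<Union>i. S \<inter> A i)" by blast
    then show ?case using approximable_Union[OF Union.IH] by simp
  qed
qed

definition inner_capacity :: "'x set \<Rightarrow> real" where
  "inner_capacity B = (SUP C\<in>{C. closed C \<and> C \<subseteq> B}. capacity C)"

lemma capacity_bdd: "bdd_above (capacity ` X)"
  by (rule bdd_aboveI[of _ 1]) (auto intro: capacity_le_1)

lemma inner_capacity_upper: "closed C \<Longrightarrow> C \<subseteq> B \<Longrightarrow> capacity C \<le> inner_capacity B"
  unfolding inner_capacity_def by (rule cSUP_upper[OF _ capacity_bdd]) simp

lemma inner_capacity_least:
  "(\<And>C. closed C \<Longrightarrow> C \<subseteq> B \<Longrightarrow> capacity C \<le> y) \<Longrightarrow> inner_capacity B \<le> y"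
  unfolding inner_capacity_def by (rule cSUP_least) auto

lemma inner_capacity_mono: "A \<subseteq> B \<Longrightarrow> inner_capacity A \<le> inner_capacity B"
  by (rule inner_capacity_least) (auto intro: inner_capacity_upper)

lemma inner_capacity_closed: "closed C \<Longrightarrow> inner_capacity C = capacity C"
  by (rule antisym) (auto intro: inner_capacity_least capacity_mono inner_capacity_upper)

lemma inner_capacity_nonneg: "0 \<le> inner_capacity B"
  using inner_capacity_upper[of "{}" B] capacity_empty by simp

lemma inner_capacity_superadditive:
  assumes "A \<subseteq> S" "B \<subseteq> S" "A \<inter> B = {}"
  shows "inner_capacity A + inner_capacity B \<le> inner_capacity (A \<union> B)"
proof -
  have main: "capacity C + capacity D \<le> inner_capacity (A \<union> B)"
    if "closed C" "C \<subseteq> A" "closed D" "D \<subseteq> B" for C D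
  proof -
    have "capacity C + capacity D \<le> capacity (C \<union> D)"
      using that assms by (intro capacity_superadditive) auto
    also have "\<dots> \<le> inner_capacity (A \<union> B)"
      using that by (intro inner_capacity_upper) auto
    finally show ?thesis .
  qed
  have "capacity C \<le> inner_capacity (A \<union> B) - inner_capacity B" if "closed C" "C \<subseteq> A" for C
  proof -
    have "capacity D \<le> inner_capacity (A \<union> B) - capacity C" if "closed D" "D \<subseteq> B" for D
      using main[OF \<open>closed C\<close> \<open>C \<subseteq> A\<close> that] by simp
    then have "inner_capacity B \<le> inner_capacity (A \<union> B) - capacity C" by (rule inner_capacity_least)
    then show ?thesis by simp
  qed
  then have "inner_capacity A \<le> inner_capacity (A \<union> B) - inner_capacity B"
    by (rule inner_capacity_least)
  then show ?thesis by simp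
qed

lemma inner_capacity_superadditive_finite:
  fixes A :: "nat \<Rightarrow> 'x set"
  assumes "\<And>i. A i \<subseteq> S" "disjoint_family A"
  shows "(\<Sum>i<n. inner_capacity (A i)) \<le> inner_capacity (\<Union>i<n. A i)"
proof (induction n)
  case 0
  then show ?case by (simp add: inner_capacity_nonneg)
next
  case (Suc n)
  have "inner_capacity (\<Union>i<n. A i) + inner_capacity (A n) \<le> inner_capacity ((\<Union>i<n. A i) \<union> A n)"
  proof (rule inner_capacity_superadditive)
    show "(\<Union>i<n. A i) \<inter> A n = {}"
      using disjoint_family_onD[OF assms(2), of _ n] by fastforce
  qed (use assms in auto)
  moreover have "(\<Union>i<Suc n. A i) = (\<Union>i<n. A i) \<union> A n"
    by (auto simp: lessThan_Suc)
  ultimately show ?case using Suc.IH by simp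
qed

text \<open>
  Superadditivity bounds the partial sums by the value of the union. For the reverse inequality, a closed
  \<open>F\<close> inside the union is disjoint from the closed set \<open>D\<close> exhausting the complement, so its capacity is at
  most \<open>1 - capacity D\<close>, which finitely many of the \<open>A i\<close> nearly fill.
\<close>

lemma inner_capacity_sums:
  fixes A :: "nat \<Rightarrow> 'x set"
  assumes A: "\<And>i. approximable (A i)" and disj: "disjoint_family A"
  shows "(\<lambda>i. inner_capacity (A i)) sums inner_capacity (\<Union>i. A i)"
  unfolding sums_def
proof (rule increasing_LIMSEQ)
  have AS: "A i \<subseteq> S" for i using A by (auto simp: approximable_def)
  show "(\<Sum>i<n. inner_capacity (A i)) \<le> (\<Sum>i<Suc n. inner_capacity (A i))" for n
    by (simp add: inner_capacity_nonneg)
  show "(\<Sum>i<n. inner_capacity (A i)) \<le> inner_capacity (\<Union>i. A i)" for n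
    using inner_capacity_superadditive_finite[OF AS disj, of n]
      inner_capacity_mono[of "\<Union>i<n. A i" "\<Union>i. A i"] by fastforce
  fix e :: real assume "0 < e"
  obtain C D n where C: "\<And>i. closed (C i)" "\<And>i. C i \<subseteq> A i" and D: "closed D" "D \<subseteq> S - (\<Union>i. A i)"
    and large: "1 - e < capacity (\<Union>i\<le>(n::nat). C i) + capacity D"
    by (rule approximable_sequence[where A = A, OF A \<open>0 < e\<close>]) (rule that)
  have "capacity (\<Union>i\<le>n. C i) \<le> (\<Sum>i\<le>n. capacity (C i))"
    by (intro capacity_subadditive_finite finite_atMost order_trans[OF C(2) AS])
  also have "\<dots> \<le> (\<Sum>i\<le>n. inner_capacity (A i))"
    using C by (intro sum_mono inner_capacity_upper)
  also have "\<dots> = (\<Sum>i<Suc n. inner_capacity (A i))" by (simp add: lessThan_Suc_atMost)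
  finally have small: "capacity (\<Union>i\<le>n. C i) \<le> (\<Sum>i<Suc n. inner_capacity (A i))" .
  have "inner_capacity (\<Union>i. A i) \<le> (\<Sum>i<Suc n. inner_capacity (A i)) + e"
  proof (rule inner_capacity_least)
    fix F assume F: "closed F" "F \<subseteq> (\<Union>i. A i)"
    have "F \<subseteq> S" "F \<inter> D = {}" using F AS D(2) by blast+
    then have "capacity F + capacity D \<le> capacity (F \<union> D)"
      using F D by (intro capacity_superadditive) auto
    also have "\<dots> \<le> 1" by (rule capacity_le_1)
    finally show "capacity F \<le> (\<Sum>i<Suc n. inner_capacity (A i)) + e"
      using large small by linarith
  qed
  then show "\<exists>n. inner_capacity (\<Union>i. A i) \<le> (\<Sum>i<n. inner_capacity (A i)) + e" by blast
qed

text \<open>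
  A Borel measure on the whole type, carried by \<open>S\<close>.
\<close>

definition capacity_measure :: "'x measure" where
  "capacity_measure = measure_of UNIV (sets borel) (\<lambda>B. ennreal (inner_capacity (S \<inter> B)))"

lemma sets_capacity_measure [measurable_cong]: "sets capacity_measure = sets borel"
  and space_capacity_measure: "space capacity_measure = UNIV"
  using sets.sigma_sets_eq[of "borel :: 'x measure"] by (simp_all add: capacity_measure_def)

lemma emeasure_capacity_measure:
  assumes "B \<in> sets borel"
  shows "emeasure capacity_measure B = ennreal (inner_capacity (S \<inter> B))"
proof (rule emeasure_measure_of[OF capacity_measure_def])
  show "positive (sets capacity_measure) (\<lambda>B. ennreal (inner_capacity (S \<inter> B)))"
    by (simp add: positive_def inner_capacity_closed capacity_empty)
  show "countably_additive (sets capacity_measure) (\<lambda>B. ennreal (inner_capacity (S \<inter> B)))"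
    unfolding countably_additive_def
  proof (intro allI impI)
    fix A :: "nat \<Rightarrow> 'x set"
    assume A: "range A \<subseteq> sets capacity_measure" "disjoint_family A"
    have "approximable (S \<inter> A i)" for i
      using A(1) by (intro approximable_borel) (auto simp: sets_capacity_measure)
    moreover have "disjoint_family (\<lambda>i. S \<inter> A i)" using A(2) by (auto simp: disjoint_family_on_def)
    ultimately have "(\<lambda>i. inner_capacity (S \<inter> A i)) sums inner_capacity (\<Union>i. S \<inter> A i)"
      by (rule inner_capacity_sums)
    then have "(\<Sum>i. ennreal (inner_capacity (S \<inter> A i))) = ennreal (inner_capacity (\<Union>i. S \<inter> A i))"
      by (intro suminf_ennreal_eq inner_capacity_nonneg)
    then show "(\<Sum>i. ennreal (inner_capacity (S \<inter> A i))) = ennreal (inner_capacity (S \<inter> (\<Union>i. A i)))"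
      by simp
  qed
qed (use assms in \<open>auto simp: sets_capacity_measure\<close>)

lemma emeasure_capacity_measure_closed:
  assumes "closed C" "C \<subseteq> S"
  shows "emeasure capacity_measure C = ennreal (capacity C)"
proof -
  have "S \<inter> C = C" using assms by blast
  then show ?thesis using emeasure_capacity_measure[of C] inner_capacity_closed[of C] assms by simp
qed

lemma finite_measure_capacity: "finite_measure capacity_measure"
  by (rule finite_measureI) (simp add: space_capacity_measure emeasure_capacity_measure)

lemma measure_capacity_measure_closed:
  assumes "closed C" "C \<subseteq> S"
  shows "measure capacity_measure C = capacity C"
  using emeasure_capacity_measure_closed[OF assms] capacity_nonneg by (simp add: measure_def)

lemma capacity_measure_null: "emeasure capacity_measure (- S) = 0"
  using S_closed by (simp add: emeasure_capacity_measure inner_capacity_closed capacity_empty borel_comp)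

lemma capacity_measure_inner_regular:
  assumes "B \<in> sets borel"
  shows "emeasure capacity_measure B = (SUP C\<in>{C. compact C \<and> C \<subseteq> S \<inter> B}. emeasure capacity_measure C)"
proof (rule antisym)
  show "emeasure capacity_measure B \<le> (SUP C\<in>{C. compact C \<and> C \<subseteq> S \<inter> B}. emeasure capacity_measure C)"
  proof (rule ennreal_le_epsilon)
    fix e :: real assume "0 < e"
    have "\<exists>C. closed C \<and> C \<subseteq> S \<inter> B \<and> inner_capacity (S \<inter> B) - e < capacity C"
    proof (rule ccontr)
      assume "\<not> ?thesis"
      then have "inner_capacity (S \<inter> B) \<le> inner_capacity (S \<inter> B) - e"
        by (intro inner_capacity_least) (meson not_less)
      then show False using \<open>0 < e\<close> by simp
    qed
    then obtain C where C: "closed C" "C \<subseteq> S \<inter> B" "inner_capacity (S \<inter> B) - e < capacity C"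
      by blast
    have "compact (S \<inter> C)" by (rule compact_Int_closed[OF compact C(1)])
    moreover have "S \<inter> C = C" using C(2) by blast
    ultimately have "compact C" by simp
    have "emeasure capacity_measure B \<le> ennreal (capacity C + e)"
      using C by (simp add: emeasure_capacity_measure[OF assms] ennreal_leI)
    also have "\<dots> = emeasure capacity_measure C + ennreal e"
      using C \<open>0 < e\<close> by (simp add: emeasure_capacity_measure_closed capacity_nonneg)
    also have "\<dots> \<le> (SUP C\<in>{C. compact C \<and> C \<subseteq> S \<inter> B}. emeasure capacity_measure C) + ennreal e"
      using C \<open>compact C\<close> by (intro add_right_mono SUP_upper) auto
    finally show "emeasure capacity_measure B \<le> (SUP C\<in>{C. compact C \<and> C \<subseteq> S \<inter> B}. emeasure capacity_measure C) + ennreal e" .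
  qed
  show "(SUP C\<in>{C. compact C \<and> C \<subseteq> S \<inter> B}. emeasure capacity_measure C) \<le> emeasure capacity_measure B"
    using assms by (intro SUP_least emeasure_mono) (auto simp: sets_capacity_measure)
qed

text \<open>
  The sum counts the integers between 1 and \<open>n y\<close>, so it equals the floor of \<open>n y\<close>. Applied to \<open>y = f x\<close>, it
  sandwiches a function with values in the unit interval by indicators of its superlevel sets.
\<close>

lemma step_sum_bounds:
  fixes y :: real
  assumes "0 \<le> y" "y \<le> 1" "0 < n"
  shows "real n * y - 1 \<le> (\<Sum>i=1..n. if real i / real n \<le> y then 1 else 0)"
    and "(\<Sum>i=1..n. if real i / real n \<le> y then 1 else 0) \<le> real n * y"
proof -
  define k where "k = nat \<lfloor>real n * y\<rfloor>"
  have "{i \<in> {1..n}. real i / real n \<le> y} = {1..k}"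
  proof -
    have "real n * y \<le> real n" using assms by (simp add: mult_left_le)
    then have "k \<le> n" unfolding k_def by linarith
    have iff: "real i / real n \<le> y \<longleftrightarrow> i \<le> k" for i
    proof -
      have "real i / real n \<le> y \<longleftrightarrow> real i \<le> real n * y" using assms by (simp add: field_simps)
      also have "\<dots> \<longleftrightarrow> int i \<le> \<lfloor>real n * y\<rfloor>" by (simp add: le_floor_iff)
      also have "\<dots> \<longleftrightarrow> i \<le> k" using assms by (simp add: k_def le_nat_iff)
      finally show ?thesis .
    qed
    show ?thesis unfolding iff using \<open>k \<le> n\<close> by auto
  qed
  then have eq: "(\<Sum>i=1..n. if real i / real n \<le> y then 1 else 0) = real k"
    by (simp add: sum.If_cases Int_def)
  have "real k = of_int \<lfloor>real n * y\<rfloor>" using assms by (simp add: k_def)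
  then have "real k \<le> real n * y" "real n * y - 1 \<le> real k"
    by linarith+
  then show "real n * y - 1 \<le> (\<Sum>i=1..n. if real i / real n \<le> y then 1 else 0)"
    "(\<Sum>i=1..n. if real i / real n \<le> y then 1 else 0) \<le> real n * y"
    unfolding eq by simp_all
qed

lemma function_bounded:
  assumes "f \<in> R"
  obtains B where "\<And>x. x \<in> S \<Longrightarrow> \<bar>f x\<bar> \<le> B"
proof -
  have "bounded (f ` S)"
    by (rule compact_imp_bounded[OF compact_continuous_image[OF continuous[OF assms] compact]])
  then obtain B where "\<forall>y\<in>f ` S. norm y \<le> B" unfolding bounded_iff by blast
  then have "\<bar>f x\<bar> \<le> B" if "x \<in> S" for x using that by simp
  then show thesis by (rule that)
qed

lemma set_integrable_capacity:
  assumes "f \<in> R"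
  shows "set_integrable capacity_measure S f"
proof -
  interpret finite_measure capacity_measure by (rule finite_measure_capacity)
  obtain B where B: "\<And>x. x \<in> S \<Longrightarrow> \<bar>f x\<bar> \<le> B" by (rule function_bounded[OF assms]) (rule that)
  have "(\<lambda>x. indicator S x *\<^sub>R f x) \<in> borel_measurable capacity_measure"
    using borel_measurable_continuous_on_indicator[OF _ continuous[OF assms]] S_closed
    by (simp add: measurable_cong_sets[OF sets_capacity_measure refl])
  moreover have "norm (indicator S x *\<^sub>R f x) \<le> \<bar>B\<bar>" for x
    using B[of x] by (auto simp: indicator_def)
  ultimately show ?thesis
    unfolding set_integrable_def by (intro integrable_const_bound[of _ "\<bar>B\<bar>"]) auto
qed

text \<open>
  The sum of the indicators of the superlevel sets \<open>f \<ge> i/n\<close> lies between \<open>n f - 1\<close> and \<open>n f\<close>. The lower bound,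
  with dominators in place of the indicators, estimates the functional; the upper bound estimates the
  integral. Both estimates meet in the sum of the capacities of the superlevel sets.
\<close>

lemma \<Lambda>_le_integral:
  assumes f: "f \<in> R" and f01: "\<And>x. x \<in> S \<Longrightarrow> 0 \<le> f x \<and> f x \<le> 1"
  shows "\<Lambda> f \<le> (LINT x:S|capacity_measure. f x)"
proof -
  interpret finite_measure capacity_measure by (rule finite_measure_capacity)
  have bound: "\<Lambda> f \<le> (LINT x:S|capacity_measure. f x) + 2 / real n" if n: "0 < n" for n :: nat
  proof -
    define F where "F i = {x \<in> S. real i / real n \<le> f x}" for i
    have F: "closed (F i)" "F i \<subseteq> S" for i
      unfolding F_def using closed_sublevel(2)[OF f S_closed subset_refl] by auto
    have "\<exists>g. g \<in> dominators (F i) \<and> \<Lambda> g < capacity (F i) + 1 / real n" for i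
    proof -
      have "0 < 1 / real n" using n by simp
      then obtain g where "g \<in> dominators (F i)" "\<Lambda> g < capacity (F i) + 1 / real n"
        by (rule capacity_approx) (rule that)
      then show ?thesis by blast
    qed
    then obtain g where g: "\<And>i. g i \<in> dominators (F i)" "\<And>i. \<Lambda> (g i) < capacity (F i) + 1 / real n"
      by metis
    then have gR: "\<And>i. g i \<in> R" by (auto simp: dominators_def)
    have "real n * \<Lambda> f = \<Lambda> (\<lambda>x. real n * f x)" by (simp add: \<Lambda>_scale[OF f])
    also have "\<dots> \<le> \<Lambda> (\<lambda>x. 1 + (\<Sum>i=1..n. g i x))"
    proof (rule \<Lambda>_mono)
      fix x assume x: "x \<in> S"
      have "real n * f x - 1 \<le> (\<Sum>i=1..n. if real i / real n \<le> f x then 1 else 0)"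
        using f01[OF x] n by (intro step_sum_bounds) auto
      also have "\<dots> \<le> (\<Sum>i=1..n. g i x)"
        using g(1) x by (intro sum_mono) (auto simp: dominators_def F_def)
      finally show "real n * f x \<le> 1 + (\<Sum>i=1..n. g i x)" by simp
    qed (intro scale f add const sum gR finite_atLeastAtMost)+
    also have "\<dots> = 1 + (\<Sum>i=1..n. \<Lambda> (g i))"
      using \<Lambda>_add[OF const sum[of "{1..n}" g]] gR by (simp add: \<Lambda>_const \<Lambda>_sum)
    also have "\<dots> \<le> 1 + (\<Sum>i=1..n. capacity (F i) + 1 / real n)"
      using g(2) by (intro add_left_mono sum_mono) (auto intro: less_imp_le)
    also have "\<dots> = 2 + (\<Sum>i=1..n. capacity (F i))" using n by (simp add: sum.distrib)
    also have "(\<Sum>i=1..n. capacity (F i)) = (\<Sum>i=1..n. (\<integral>x. indicator (F i) x \<partial>capacity_measure))"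
      using F by (simp add: measure_capacity_measure_closed space_capacity_measure)
    also have "\<dots> = (\<integral>x. (\<Sum>i=1..n. indicator (F i) x) \<partial>capacity_measure)"
      using F by (intro Bochner_Integration.integral_sum[symmetric])
        (auto simp: sets_capacity_measure less_top[symmetric])
    also have "\<dots> \<le> (\<integral>x. real n * (indicator S x *\<^sub>R f x) \<partial>capacity_measure)"
    proof (rule integral_mono)
      show "integrable capacity_measure (\<lambda>x. \<Sum>i=1..n. indicator (F i) x :: real)"
        using F by (intro Bochner_Integration.integrable_sum) 
          (auto simp: sets_capacity_measure less_top[symmetric])
      show "integrable capacity_measure (\<lambda>x. real n * (indicator S x *\<^sub>R f x))"
        using set_integrable_capacity[OF f] unfolding set_integrable_def by (rule integrable_mult_right)
      fix x
      show "(\<Sum>i=1..n. indicator (F i) x) \<le> real n * (indicator S x *\<^sub>R f x)"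
      proof (cases "x \<in> S")
        case True
        have "(\<Sum>i=1..n. indicator (F i) x) = (\<Sum>i=1..n. if real i / real n \<le> f x then 1 else 0 :: real)"
          using True by (intro sum.cong) (auto simp: F_def)
        also have "\<dots> \<le> real n * f x" using f01[OF True] n by (intro step_sum_bounds) auto
        finally show ?thesis using True by simp
      next
        case False
        then have "x \<notin> F i" for i by (simp add: F_def)
        then show ?thesis using False by simp
      qed
    qed
    also have "\<dots> = real n * (LINT x:S|capacity_measure. f x)"
      by (simp add: set_lebesgue_integral_def)
    finally show ?thesis using n by (simp add: field_simps)
  qed
  show ?thesis
  proof (rule LIMSEQ_le_const)
    show "(\<lambda>n. (LINT x:S|capacity_measure. f x) + 2 / real n) \<longlonglongrightarrow> (LINT x:S|capacity_measure. f x)"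
      using tendsto_add[OF tendsto_const lim_const_over_n[of 2]] by simp
    show "\<exists>N. \<forall>n\<ge>N. \<Lambda> f \<le> (LINT x:S|capacity_measure. f x) + 2 / real n"
      using bound by (intro exI[of _ 1]) auto
  qed
qed

text \<open>
  Every member of the algebra is bounded on \<open>S\<close>, hence an affine image of a function with values in the
  unit interval, which gives the inequality \<open>\<le>\<close>. The inequality for \<open>- f\<close> is the reverse one.
\<close>

lemma \<Lambda>_eq_integral:
  assumes f: "f \<in> R"
  shows "\<Lambda> f = (LINT x:S|capacity_measure. f x)"
proof -
  let ?I = "\<lambda>f. LINT x:S|capacity_measure. f x"
  obtain B0 where B0: "\<And>x. x \<in> S \<Longrightarrow> \<bar>f x\<bar> \<le> B0" by (rule function_bounded[OF f]) (rule that)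
  define B where "B = \<bar>B0\<bar> + 1"
  have B: "0 < B" "\<And>x. x \<in> S \<Longrightarrow> \<bar>f x\<bar> \<le> B" using B0 by (force simp: B_def)+
  have one: "?I (\<lambda>_. c) = c" for c :: real
  proof -
    have "?I (\<lambda>_. c) = (\<integral>x. indicator S x \<partial>capacity_measure) * c"
      unfolding set_lebesgue_integral_def real_scaleR_def
      by (rule integral_mult_left_zero)
    then show ?thesis
      using S_closed by (simp add: measure_capacity_measure_closed space_capacity_measure capacity_whole)
  qed
  have upper: "\<Lambda> h \<le> ?I h" if h: "h \<in> R" "\<And>x. x \<in> S \<Longrightarrow> \<bar>h x\<bar> \<le> B" for h
  proof -
    define k where "k = (\<lambda>x. 1/(2*B) * (h x + B))"
    have kR: "(\<lambda>x. h x + B) \<in> R" "k \<in> R" unfolding k_def by (intro scale add h const)+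
    have "\<Lambda> k \<le> ?I k"
    proof (rule \<Lambda>_le_integral[OF kR(2)])
      fix x assume "x \<in> S"
      then have "0 \<le> h x + B" "h x + B \<le> 2 * B" using h(2)[of x] by auto
      then show "0 \<le> k x \<and> k x \<le> 1" using B(1) by (simp add: k_def)
    qed
    moreover have "\<Lambda> k = 1/(2*B) * (\<Lambda> h + B)"
      using \<Lambda>_scale[OF kR(1), of "1/(2*B)"] \<Lambda>_add[OF h(1) const[of B]] by (simp add: k_def \<Lambda>_const)
    moreover have "?I k = 1/(2*B) * (?I h + B)"
    proof -
      have "?I k = 1/(2*B) * ?I (\<lambda>x. h x + B)" unfolding k_def by (rule set_integral_mult_right)
      also have "?I (\<lambda>x. h x + B) = ?I h + B"
        using set_integral_add(2)[OF set_integrable_capacity[OF h(1)] set_integrable_capacity[OF const[of B]]] one[of B]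
        by simp
      finally show ?thesis .
    qed
    ultimately show ?thesis using B(1) by (simp add: divide_right_mono divide_le_cancel)
  qed
  have "\<Lambda> (\<lambda>x. - f x) = - \<Lambda> f" using \<Lambda>_scale[OF f, of "-1"] by simp
  moreover have "?I (\<lambda>x. - f x) = - ?I f" by (simp add: set_lebesgue_integral_def)
  ultimately show ?thesis
    using upper[OF f B(2)] upper[OF minus[OF f]] B(2) by simp
qed

end

section \<open>Representing measures\<close>

lemma character_topology_eq: "character_topology = top_of_set characters"
  by (simp add: character_topology_def euclidean_product_topology)

lemma charactersD:
  assumes "\<alpha> \<in> characters"
  shows "\<alpha> (x + y) = \<alpha> x + \<alpha> y" "\<alpha> (x - y) = \<alpha> x - \<alpha> y" "\<alpha> (c *\<^sub>R x) = c * \<alpha> x" "\<alpha> 1 = 1"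
    "\<alpha> (x * y) = \<alpha> x * \<alpha> y" "\<alpha> (x ^ n) = \<alpha> x ^ n" "\<alpha> (of_real c) = c"
proof -
  have lin: "linear \<alpha>" and one: "\<alpha> 1 = 1" and mult: "\<And>x y. \<alpha> (x * y) = \<alpha> x * \<alpha> y"
    using assms by (auto simp: characters_def)
  show "\<alpha> (x + y) = \<alpha> x + \<alpha> y" "\<alpha> (x - y) = \<alpha> x - \<alpha> y" "\<alpha> (c *\<^sub>R x) = c * \<alpha> x" "\<alpha> 1 = 1"
    "\<alpha> (x * y) = \<alpha> x * \<alpha> y"
    using lin one mult by (simp_all add: linear_add linear_diff linear_scale)
  show "\<alpha> (x ^ n) = \<alpha> x ^ n" by (induction n) (simp_all add: one mult)
  show "\<alpha> (of_real c) = c" using lin one by (simp add: of_real_def linear_scale)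
qed

lemma root_sup_finiteI:
  assumes "0 \<le> B" "\<And>n. 1 \<le> n \<Longrightarrow> 0 \<le> L (a^(2*n)) \<and> L (a^(2*n)) \<le> B^(2*n)"
  shows "root_sup_finite L a"
proof -
  have "root_sup L a \<le> ereal B"
    unfolding root_sup_def
  proof (rule SUP_least)
    fix n :: nat assume "n \<in> {1..}"
    then have n: "1 \<le> n" "0 < 2*n" by auto
    have "root (2*n) (L (a^(2*n))) \<le> root (2*n) (B^(2*n))"
      using n assms(2)[OF n(1)] by (intro real_root_le_mono) auto
    also have "\<dots> = B" using n(2) assms(1) by (rule real_root_power_cancel)
    finally show "ereal (root (2*n) (L (a^(2*n)))) \<le> ereal B" by simp
  qed
  also have "\<dots> < \<infinity>" by simp
  finally show ?thesis using assms(2) by (simp add: root_sup_finite_def)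
qed

text \<open>
  Under the finiteness condition the supremum is a real number, so the conversions between extended and
  ordinary real numbers lose nothing.
\<close>

lemma root_sup_finiteD:
  assumes "root_sup_finite L a"
  shows "0 \<le> C_const L a" "1 \<le> n \<Longrightarrow> L (a^(2*n)) \<le> (C_const L a)^(2*n)"
proof -
  have nn: "\<And>n. 1 \<le> n \<Longrightarrow> 0 \<le> L (a^(2*n))" and fin: "root_sup L a < \<infinity>"
    using assms by (auto simp: root_sup_finite_def)
  have up: "ereal (root (2*n) (L (a^(2*n)))) \<le> root_sup L a" if "1 \<le> n" for n
    unfolding root_sup_def by (rule SUP_upper) (use that in simp)
  have "\<bar>root_sup L a\<bar> \<noteq> \<infinity>" using up[of 1] fin by (cases "root_sup L a") auto
  then have eq: "ereal (C_const L a) = root_sup L a"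
    unfolding C_const_def by (rule ereal_real')
  have le: "root (2*n) (L (a^(2*n))) \<le> C_const L a" if "1 \<le> n" for n
    using up[OF that] unfolding eq[symmetric] by simp
  show C0: "0 \<le> C_const L a"
    using le[of 1] real_root_ge_zero[OF nn[of 1], of "2*1"] by linarith
  show "L (a^(2*n)) \<le> (C_const L a)^(2*n)" if n: "1 \<le> n"
  proof -
    have "L (a^(2*n)) = root (2*n) (L (a^(2*n))) ^ (2*n)"
      using n nn[OF n] by (intro real_root_pow_pos2[symmetric]) auto
    also have "\<dots> \<le> (C_const L a)^(2*n)"
      using n nn[OF n] le[OF n] by (intro power_mono real_root_ge_zero) auto
    finally show ?thesis .
  qed
qed

lemma open_in_sets_radon:
  assumes "radon_measure_on T \<mu>" "openin T U"
  shows "U \<in> sets \<mu>"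
  using assms by (auto simp: radon_measure_on_def intro: sigma_sets.Basic)

lemma closedin_measure_support: "closedin T (measure_support T \<mu>)"
proof -
  have "topspace T - measure_support T \<mu> = \<Union>{U. openin T U \<and> emeasure \<mu> U = 0}"
  proof (intro equalityI subsetI)
    fix x assume "x \<in> topspace T - measure_support T \<mu>"
    then show "x \<in> \<Union>{U. openin T U \<and> emeasure \<mu> U = 0}" by (auto simp: measure_support_def)
  next
    fix x assume "x \<in> \<Union>{U. openin T U \<and> emeasure \<mu> U = 0}"
    then obtain U where "openin T U" "emeasure \<mu> U = 0" "x \<in> U" by blast
    then show "x \<in> topspace T - measure_support T \<mu>"
      using openin_subset[of T U] by (auto simp: measure_support_def)
  qed
  moreover have "openin T (\<Union>{U. openin T U \<and> emeasure \<mu> U = 0})" by (rule openin_Union) simp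
  moreover have "measure_support T \<mu> \<subseteq> topspace T" by (auto simp: measure_support_def)
  ultimately show ?thesis by (simp add: closedin_def)
qed

text \<open>
  The complement of the support is a union of open null sets, possibly uncountably many. Each compact subset
  is covered by finitely many of them and is therefore null; inner regularity does the rest.
\<close>

lemma radon_null_off_support:
  assumes "radon_measure_on T \<mu>"
  shows "emeasure \<mu> (topspace T - measure_support T \<mu>) = 0"
proof -
  let ?N = "topspace T - measure_support T \<mu>"
  have open_N: "openin T ?N" by (simp add: openin_diff closedin_measure_support)
  have "emeasure \<mu> C = 0" if C: "compactin T C" "C \<subseteq> ?N" for C
  proof -
    have "C \<subseteq> \<Union>{U. openin T U \<and> emeasure \<mu> U = 0}"
    proof
      fix x assume "x \<in> C"
      then have "x \<in> ?N" using C by blast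
      then show "x \<in> \<Union>{U. openin T U \<and> emeasure \<mu> U = 0}" by (auto simp: measure_support_def)
    qed
    then obtain \<F> where F: "finite \<F>" "\<F> \<subseteq> {U. openin T U \<and> emeasure \<mu> U = 0}" "C \<subseteq> \<Union>\<F>"
      using C(1) unfolding compactin_def by (metis (mono_tags, lifting) mem_Collect_eq)
    have "\<Union>\<F> \<in> null_sets \<mu>"
      using F by (intro null_sets_UN'[of \<F> "\<lambda>U. U", simplified])
        (auto simp: null_sets_def countable_finite intro: open_in_sets_radon[OF assms])
    then have "emeasure \<mu> (\<Union>\<F>) = 0" "\<Union>\<F> \<in> sets \<mu>" by auto
    then show ?thesis using emeasure_mono[OF F(3), of \<mu>] by simp
  qed
  then have "(SUP C\<in>{C. compactin T C \<and> C \<subseteq> ?N}. emeasure \<mu> C) \<le> 0" by (intro SUP_least) auto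
  moreover have "emeasure \<mu> ?N = (SUP C\<in>{C. compactin T C \<and> C \<subseteq> ?N}. emeasure \<mu> C)"
    using assms open_in_sets_radon[OF assms open_N] unfolding radon_measure_on_def by blast
  ultimately show ?thesis by simp
qed

lemma sigma_sets_characters:
  "sigma_sets characters {U. openin (top_of_set characters) U}
     = sets (restrict_space borel (characters :: ('a::{comm_ring_1, real_algebra_1} \<Rightarrow> real) set))"
proof -
  let ?X = "characters :: ('a \<Rightarrow> real) set"
  have "sets (restrict_space borel ?X) = (\<inter>) ?X ` sigma_sets UNIV {S. open S}"
    by (simp add: sets_restrict_space borel_def)
  also have "\<dots> = sigma_sets ?X ((\<inter>) ?X ` {S. open S})"
    using closed_characters borel_closed[OF closed_characters] 
    by (intro sigma_sets_Int) (simp_all add: borel_def)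
  also have "(\<inter>) ?X ` {S. open S} = {U. openin (top_of_set ?X) U}"
    by (auto simp: openin_open)
  finally show ?thesis by simp
qed

lemma representing_measureD:
  assumes "representing_measure L \<mu>"
  shows "radon_measure_on character_topology \<mu>" "space \<mu> = characters"
    "sets \<mu> = sets (restrict_space borel characters)"
    "integrable \<mu> (\<lambda>\<alpha>. \<alpha> a)" "L a = (\<integral>\<alpha>. \<alpha> a \<partial>\<mu>)"
  using assms sigma_sets_characters
  by (simp_all add: representing_measure_def radon_measure_on_def character_topology_eq)

lemma closed_in_sets_representing:
  assumes "representing_measure L \<mu>" "closed C" "C \<subseteq> characters"
  shows "C \<in> sets \<mu>"
  unfolding representing_measureD(3)[OF assms(1)] sets_restrict_space
  by (rule image_eqI[of _ _ C]) (use assms in auto)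

lemma total_mass_representing:
  assumes "representing_measure L \<mu>" "L 1 = 1"
  shows "finite_measure \<mu>" "measure \<mu> (space \<mu>) = 1"
proof -
  note rD = representing_measureD[OF assms(1)]
  have "integrable \<mu> (\<lambda>\<alpha>. \<alpha> 1) \<longleftrightarrow> integrable \<mu> (\<lambda>_. 1::real)"
    by (rule Bochner_Integration.integrable_cong) (auto simp: rD(2) charactersD)
  then have int: "integrable \<mu> (\<lambda>_. 1::real)" using rD(4) by blast
  then have "emeasure \<mu> (space \<mu>) < \<infinity>" by (simp add: integrable_iff_bounded)
  then show "finite_measure \<mu>" by (intro finite_measureI) auto
  have "1 = (\<integral>\<alpha>. \<alpha> 1 \<partial>\<mu>)" using rD(5)[of 1] assms(2) by simp
  also have "\<dots> = (\<integral>\<alpha>. 1 \<partial>\<mu>)"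
    by (rule Bochner_Integration.integral_cong) (auto simp: rD(2) charactersD)
  finally show "measure \<mu> (space \<mu>) = 1" by simp
qed

lemma compactin_characters: "compactin character_topology K \<longleftrightarrow> compact K \<and> K \<subseteq> characters"
  by (auto simp: character_topology_eq compactin_subtopology)

lemma compact_support_AE:
  assumes "representing_measure L \<mu>" "compactin character_topology (measure_support character_topology \<mu>)"
  obtains K where "compact K" "K \<subseteq> characters" "AE \<alpha> in \<mu>. \<alpha> \<in> K"
proof -
  note rD = representing_measureD[OF assms(1)]
  let ?K = "measure_support character_topology \<mu>"
  have K: "compact ?K" "?K \<subseteq> characters" using assms(2) by (simp_all add: compactin_characters)
  have "emeasure \<mu> (characters - ?K) = 0"
    using radon_null_off_support[OF rD(1)] by (simp add: character_topology_eq)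
  moreover have "characters - ?K \<in> sets \<mu>"
    using closed_in_sets_representing[OF assms(1)] K compact_imp_closed[OF K(1)] closed_characters by blast
  ultimately have "characters - ?K \<in> null_sets \<mu>" by (simp add: null_sets_def)
  then have "AE \<alpha> in \<mu>. \<alpha> \<notin> characters - ?K" by (rule AE_not_in)
  then have "AE \<alpha> in \<mu>. \<alpha> \<in> ?K" using AE_space by eventually_elim (simp add: rD(2))
  then show thesis using that K by blast
qed

lemma compact_evaluation_bounded:
  assumes "compact (K :: ('i \<Rightarrow> real) set)"
  obtains B where "0 \<le> B" "\<And>\<alpha>. \<alpha> \<in> K \<Longrightarrow> \<bar>\<alpha> a\<bar> \<le> B"
proof -
  have "continuous_on K (\<lambda>\<alpha>. \<alpha> a)"
    by (rule continuous_on_subset[OF continuous_on_product_coordinates]) simp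
  then have "bounded ((\<lambda>\<alpha>. \<alpha> a) ` K)"
    using compact_continuous_image assms compact_imp_bounded by blast
  then obtain B where "\<forall>y\<in>(\<lambda>\<alpha>. \<alpha> a) ` K. norm y \<le> B" unfolding bounded_iff by blast
  then have "\<bar>\<alpha> a\<bar> \<le> \<bar>B\<bar>" if "\<alpha> \<in> K" for \<alpha> using that by force
  then show thesis using that[of "\<bar>B\<bar>"] by simp
qed

lemma representing_moment:
  assumes "representing_measure L \<mu>"
  shows "integrable \<mu> (\<lambda>\<alpha>. \<alpha> a ^ n)" "L (a ^ n) = (\<integral>\<alpha>. \<alpha> a ^ n \<partial>\<mu>)"
proof -
  note rD = representing_measureD[OF assms]
  have "integrable \<mu> (\<lambda>\<alpha>. \<alpha> (a ^ n)) \<longleftrightarrow> integrable \<mu> (\<lambda>\<alpha>. \<alpha> a ^ n)"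
    by (rule Bochner_Integration.integrable_cong) (auto simp: rD(2) charactersD)
  then show "integrable \<mu> (\<lambda>\<alpha>. \<alpha> a ^ n)" using rD(4) by blast
  have "(\<integral>\<alpha>. \<alpha> (a ^ n) \<partial>\<mu>) = (\<integral>\<alpha>. \<alpha> a ^ n \<partial>\<mu>)"
    by (rule Bochner_Integration.integral_cong) (auto simp: rD(2) charactersD)
  then show "L (a ^ n) = (\<integral>\<alpha>. \<alpha> a ^ n \<partial>\<mu>)" using rD(5) by simp
qed

text \<open>
  Markov's inequality gives \<open>\<mu> {\<bar>\<alpha> a\<bar> \<ge> t} \<le> (C/t)^(2 n)\<close> for every \<open>n\<close>, which tends to 0 if \<open>t > C\<close>.
\<close>

lemma moment_bound_AE:
  assumes rep: "representing_measure L \<mu>" and "L 1 = 1" and C0: "0 \<le> C"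
    and C: "\<And>n. 1 \<le> n \<Longrightarrow> L (a^(2*n)) \<le> C^(2*n)"
  shows "AE \<alpha> in \<mu>. \<bar>\<alpha> a\<bar> \<le> C"
proof -
  interpret finite_measure \<mu> by (rule total_mass_representing[OF assms(1,2)])
  note rD = representing_measureD[OF rep]
  have [measurable]: "(\<lambda>\<alpha>. \<alpha> a) \<in> borel_measurable \<mu>" using rD(4) by (rule borel_measurable_integrable)
  have above: "AE \<alpha> in \<mu>. \<bar>\<alpha> a\<bar> < t" if t: "C < t" for t
  proof -
    define A where "A = {\<alpha> \<in> space \<mu>. t \<le> \<bar>\<alpha> a\<bar>}"
    have A[measurable]: "A \<in> sets \<mu>" unfolding A_def by measurable
    have t0: "0 < t" using t C0 by simp
    have bound: "measure \<mu> A \<le> ((C/t)^2)^n" if n: "1 \<le> n" for n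
    proof -
      have "t^(2*n) * measure \<mu> A = (\<integral>\<alpha>. t^(2*n) * indicator A \<alpha> \<partial>\<mu>)" by simp
      also have "\<dots> \<le> (\<integral>\<alpha>. \<alpha> a ^ (2*n) \<partial>\<mu>)"
      proof (rule integral_mono)
        show "integrable \<mu> (\<lambda>\<alpha>. t^(2*n) * indicator A \<alpha> :: real)"
          by (intro integrable_mult_right integrable_real_indicator A) (simp add: less_top[symmetric])
        show "integrable \<mu> (\<lambda>\<alpha>. \<alpha> a ^ (2*n))" by (rule representing_moment[OF rep])
        fix \<alpha>
        have "t^(2*n) \<le> \<alpha> a ^ (2*n)" if "t \<le> \<bar>\<alpha> a\<bar>"
        proof -
          have "t^(2*n) \<le> \<bar>\<alpha> a\<bar>^(2*n)" using that t0 by (intro power_mono) auto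
          then show ?thesis by (simp add: power_even_abs)
        qed
        then show "t^(2*n) * indicator A \<alpha> \<le> \<alpha> a ^ (2*n)"
          by (auto simp: A_def indicator_def)
      qed
      also have "\<dots> \<le> C^(2*n)" using C[OF n] representing_moment(2)[OF rep] by simp
      finally have "measure \<mu> A \<le> C^(2*n) / t^(2*n)"
        using t0 by (simp add: pos_le_divide_eq mult.commute)
      also have "\<dots> = ((C/t)^2)^n" by (simp only: power_divide flip: power_mult)
      finally show ?thesis .
    qed
    have "(C/t)^2 < 1^2" using t C0 t0 by (intro power_strict_mono) auto
    then have "(\<lambda>n. ((C/t)^2)^n) \<longlonglongrightarrow> 0" by (intro LIMSEQ_power_zero) simp
    then have "measure \<mu> A \<le> 0"
      by (rule LIMSEQ_le_const) (use bound in \<open>blast intro: exI[of _ 1]\<close>)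
    then have "measure \<mu> A = 0" using measure_nonneg[of \<mu> A] by linarith
    then have "A \<in> null_sets \<mu>" by (simp add: null_sets_def emeasure_eq_measure)
    then have "AE \<alpha> in \<mu>. \<alpha> \<notin> A" by (rule AE_not_in)
    then show ?thesis using AE_space by eventually_elim (simp add: A_def)
  qed
  have "AE \<alpha> in \<mu>. \<forall>n. \<bar>\<alpha> a\<bar> < C + 1 / real (Suc n)"
    using above by (simp add: AE_all_countable)
  then show ?thesis
  proof eventually_elim
    case (elim \<alpha>)
    show ?case
    proof (rule field_le_epsilon)
      fix e :: real assume "0 < e"
      then obtain n where "1 / real (Suc n) < e" by (metis nat_approx_posE)
      then show "\<bar>\<alpha> a\<bar> \<le> C + e" using elim[rule_format, of n] by linarith
    qed
  qed
qed

lemma representing_imp_root_sup_finite: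
  assumes rep: "representing_measure L \<mu>" and "L 1 = 1"
    and comp: "compactin character_topology (measure_support character_topology \<mu>)"
  shows "root_sup_finite L a"
proof -
  interpret finite_measure \<mu> by (rule total_mass_representing[OF assms(1,2)])
  obtain K where K: "compact K" "K \<subseteq> characters" "AE \<alpha> in \<mu>. \<alpha> \<in> K"
    by (rule compact_support_AE[OF rep comp])
  obtain B where B: "0 \<le> B" "\<And>\<alpha>. \<alpha> \<in> K \<Longrightarrow> \<bar>\<alpha> a\<bar> \<le> B"
    by (rule compact_evaluation_bounded[OF K(1)]) (rule that)
  show ?thesis
  proof (rule root_sup_finiteI[OF B(1)])
    fix n :: nat assume "1 \<le> n"
    have "(\<integral>\<alpha>. \<alpha> a ^ (2*n) \<partial>\<mu>) \<le> (\<integral>\<alpha>. B^(2*n) \<partial>\<mu>)"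
    proof (rule integral_mono_AE[OF representing_moment(1)[OF rep]])
      show "AE \<alpha> in \<mu>. \<alpha> a ^ (2*n) \<le> B^(2*n)"
        using K(3)
      proof eventually_elim
        case (elim \<alpha>)
        have "\<alpha> a ^ (2*n) = \<bar>\<alpha> a\<bar> ^ (2*n)" by (simp add: power_even_abs)
        also have "\<dots> \<le> B^(2*n)" using B(2)[OF elim] by (intro power_mono) auto
        finally show ?case .
      qed
    qed simp
    also have "\<dots> = B^(2*n)" using total_mass_representing(2)[OF assms(1,2)] by simp
    finally have "L (a^(2*n)) \<le> B^(2*n)" using representing_moment(2)[OF rep] by simp
    moreover have "0 \<le> L (a^(2*n))"
      unfolding representing_moment(2)[OF rep] by (intro integral_nonneg_AE) simp
    ultimately show "0 \<le> L (a^(2*n)) \<and> L (a^(2*n)) \<le> B^(2*n)" by simp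
  qed
qed

lemma representing_imp_products_nonneg:
  assumes rep: "representing_measure L \<mu>" and "L 1 = 1" and fin: "root_sup_finite L a"
  shows "0 \<le> L ((of_real (C_const L a) - a) ^ j * (of_real (C_const L a) + a) ^ k)"
proof -
  note rD = representing_measureD[OF rep]
  have "AE \<alpha> in \<mu>. \<bar>\<alpha> a\<bar> \<le> C_const L a"
    by (rule moment_bound_AE[OF assms(1,2)]) (use root_sup_finiteD[OF fin] in auto)
  then have "AE \<alpha> in \<mu>. 0 \<le> \<alpha> ((of_real (C_const L a) - a) ^ j * (of_real (C_const L a) + a) ^ k)"
    using AE_space
  proof eventually_elim
    case (elim \<alpha>)
    then show ?case by (auto simp: rD(2) charactersD intro!: mult_nonneg_nonneg zero_le_power)
  qed
  then show ?thesis unfolding rD(5) by (rule integral_nonneg_AE)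
qed


text \<open>
  Products of evaluations are evaluations only at characters. The functions are therefore determined on
  \<open>K\<close> alone; requiring equality everywhere would not give an algebra.
\<close>

definition evaluation_functions :: "('a \<Rightarrow> real) set \<Rightarrow> (('a \<Rightarrow> real) \<Rightarrow> real) set" where
  "evaluation_functions K = {f. \<exists>a. \<forall>\<alpha>\<in>K. f \<alpha> = \<alpha> a}"

lemma function_ring_evaluations:
  fixes K :: "('a::{comm_ring_1, real_algebra_1} \<Rightarrow> real) set"
  assumes K: "compact K" "K \<subseteq> characters"
  shows "function_ring_on (evaluation_functions K) K"
proof -
  have cD: "\<alpha> (x + y) = \<alpha> x + \<alpha> y" "\<alpha> (x * y) = \<alpha> x * \<alpha> y" "\<alpha> (of_real c) = c" if "\<alpha> \<in> K" for \<alpha> x y c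
    using that K(2) charactersD by blast+
  show ?thesis
  proof
    show "compact K" by (rule K)
    fix f g assume "f \<in> evaluation_functions K" "g \<in> evaluation_functions K"
    then obtain a b where ab: "\<And>\<alpha>. \<alpha> \<in> K \<Longrightarrow> f \<alpha> = \<alpha> a" "\<And>\<alpha>. \<alpha> \<in> K \<Longrightarrow> g \<alpha> = \<alpha> b"
      by (auto simp: evaluation_functions_def)
    have "continuous_on K (\<lambda>\<alpha>. \<alpha> a)"
      by (rule continuous_on_subset[OF continuous_on_product_coordinates]) simp
    then show "continuous_on K f" by (rule continuous_on_eq) (simp add: ab)
    show "(\<lambda>x. f x + g x) \<in> evaluation_functions K"
      unfolding evaluation_functions_def using ab cD by (intro CollectI exI[of _ "a + b"]) simp
    show "(\<lambda>x. f x * g x) \<in> evaluation_functions K"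
      unfolding evaluation_functions_def using ab cD by (intro CollectI exI[of _ "a * b"]) simp
  next
    fix c :: real
    show "(\<lambda>_. c) \<in> evaluation_functions K"
      unfolding evaluation_functions_def by (intro CollectI exI[of _ "of_real c"]) (simp add: cD)
  next
    fix x y assume "x \<in> K" "y \<in> K" "x \<noteq> y"
    then obtain a where "x a \<noteq> y a" by blast
    moreover have "(\<lambda>\<alpha>. \<alpha> a) \<in> evaluation_functions K" by (auto simp: evaluation_functions_def)
    ultimately show "\<exists>f\<in>evaluation_functions K. f x \<noteq> f y" by (intro bexI[of _ "\<lambda>\<alpha>. \<alpha> a"])
  qed
qed

text \<open>
  Positivity on \<open>K\<close> also shows that \<open>L a\<close> depends only on the values of \<open>a\<close> on \<open>K\<close>. Thus \<open>L\<close> induces a positive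
  functional on the algebra of evaluations, and the Riesz measure of this functional is restricted to the
  space of characters.
\<close>

lemma representing_measure_exists:
  fixes L :: "'a::{comm_ring_1, real_algebra_1} \<Rightarrow> real"
  assumes L: "linear L" and one: "L 1 = 1" and K: "compact K" "K \<subseteq> characters"
    and pos: "\<And>a. (\<And>\<alpha>. \<alpha> \<in> K \<Longrightarrow> 0 \<le> \<alpha> a) \<Longrightarrow> 0 \<le> L a"
  obtains \<nu> where "representing_measure L \<nu>"
    "compactin character_topology (measure_support character_topology \<nu>)"
proof -
  interpret L: linear L by (rule L)
  have cD: "\<alpha> (x + y) = \<alpha> x + \<alpha> y" "\<alpha> (x - y) = \<alpha> x - \<alpha> y" "\<alpha> (c *\<^sub>R x) = c * \<alpha> x" "\<alpha> 1 = 1"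
    if "\<alpha> \<in> K" for \<alpha> x y c
    using that K(2) charactersD by blast+
  define \<Lambda> where "\<Lambda> f = L (SOME a. \<forall>\<alpha>\<in>K. f \<alpha> = \<alpha> a)" for f
  have \<Lambda>_eq: "\<Lambda> f = L a" if f: "\<And>\<alpha>. \<alpha> \<in> K \<Longrightarrow> f \<alpha> = \<alpha> a" for f a
  proof -
    define b where "b = (SOME a. \<forall>\<alpha>\<in>K. f \<alpha> = \<alpha> a)"
    have "\<forall>\<alpha>\<in>K. f \<alpha> = \<alpha> b" unfolding b_def by (rule someI[of _ a]) (use f in simp)
    then have eq: "\<alpha> a = \<alpha> b" if "\<alpha> \<in> K" for \<alpha> using that f by simp
    \<comment> \<open>both differences vanish on \<open>K\<close>\<close>
    have "0 \<le> L (a - b)" "0 \<le> L (b - a)" by (rule pos; simp add: cD eq)+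
    then show ?thesis by (simp add: \<Lambda>_def b_def L.diff)
  qed
  interpret positive_functional_on "evaluation_functions K" K \<Lambda>
  proof (intro positive_functional_on.intro positive_functional_on_axioms.intro function_ring_evaluations K)
    fix f g assume fg: "f \<in> evaluation_functions K" "g \<in> evaluation_functions K"
    then obtain a b where ab: "\<And>\<alpha>. \<alpha> \<in> K \<Longrightarrow> f \<alpha> = \<alpha> a" "\<And>\<alpha>. \<alpha> \<in> K \<Longrightarrow> g \<alpha> = \<alpha> b"
      by (auto simp: evaluation_functions_def)
    have "\<Lambda> (\<lambda>x. f x + g x) = L (a + b)" by (rule \<Lambda>_eq) (simp add: ab cD)
    then show "\<Lambda> (\<lambda>x. f x + g x) = \<Lambda> f + \<Lambda> g" using \<Lambda>_eq ab by (simp add: L.add)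
  next
    fix f and c :: real assume "f \<in> evaluation_functions K"
    then obtain a where a: "\<And>\<alpha>. \<alpha> \<in> K \<Longrightarrow> f \<alpha> = \<alpha> a" by (auto simp: evaluation_functions_def)
    have "\<Lambda> (\<lambda>x. c * f x) = L (c *\<^sub>R a)" by (rule \<Lambda>_eq) (simp add: a cD)
    then show "\<Lambda> (\<lambda>x. c * f x) = c * \<Lambda> f" using \<Lambda>_eq a by (simp add: L.scale)
  next
    fix f assume "f \<in> evaluation_functions K" and f0: "\<And>x. x \<in> K \<Longrightarrow> 0 \<le> f x"
    then obtain a where a: "\<And>\<alpha>. \<alpha> \<in> K \<Longrightarrow> f \<alpha> = \<alpha> a" by (auto simp: evaluation_functions_def)
    then have "0 \<le> L a" using f0 by (intro pos) fastforce
    then show "0 \<le> \<Lambda> f" using \<Lambda>_eq a by simp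
  next
    have "\<Lambda> (\<lambda>_. 1) = L 1" by (rule \<Lambda>_eq) (simp add: cD)
    then show "\<Lambda> (\<lambda>_. 1) = 1" using one by simp
  qed
  let ?M = "capacity_measure"
  let ?X = "characters :: ('a \<Rightarrow> real) set"
  define \<nu> where "\<nu> = restrict_space ?M ?X"
  interpret M: finite_measure ?M by (rule finite_measure_capacity)
  have X[measurable]: "?X \<in> sets borel" using closed_characters by (rule borel_closed)
  have XM: "?X \<inter> space ?M \<in> sets ?M" by (simp add: sets_capacity_measure space_capacity_measure)
  have sets_\<nu>: "sets \<nu> = sets (restrict_space borel ?X)"
    unfolding \<nu>_def by (rule sets_restrict_space_cong[OF sets_capacity_measure])
  have space_\<nu>: "space \<nu> = ?X" by (simp add: \<nu>_def space_restrict_space space_capacity_measure)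
  have em: "emeasure \<nu> B = emeasure ?M B" if "B \<subseteq> ?X" for B
    unfolding \<nu>_def by (rule emeasure_restrict_space[OF XM that])
  have "- K \<in> null_sets ?M"
    using capacity_measure_null S_closed by (simp add: null_sets_def sets_capacity_measure borel_comp)
  then have "AE \<alpha> in ?M. \<alpha> \<notin> - K" by (rule AE_not_in)
  then have AEK: "AE \<alpha> in ?M. \<alpha> \<in> K" by simp
  have radon: "radon_measure_on character_topology \<nu>"
    unfolding radon_measure_on_def
  proof (intro conjI ballI)
    show "space \<nu> = topspace character_topology" by (simp add: space_\<nu> character_topology_eq)
    show "sets \<nu> = sigma_sets (topspace character_topology) {U. openin character_topology U}"
      by (simp add: sets_\<nu> character_topology_eq sigma_sets_characters)
    fix x :: "'a \<Rightarrow> real" assume "x \<in> topspace character_topology"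
    then show "\<exists>U. openin character_topology U \<and> x \<in> U \<and> emeasure \<nu> U < \<infinity>"
      by (intro exI[of _ ?X]) (simp add: character_topology_eq em less_top[symmetric])
  next
    fix B assume "B \<in> sets \<nu>"
    then have B: "B \<subseteq> ?X" "B \<in> sets borel"
      using X by (auto simp: sets_\<nu> sets_restrict_space)
    have "emeasure \<nu> B = (SUP C\<in>{C. compact C \<and> C \<subseteq> K \<inter> B}. emeasure ?M C)"
      by (simp add: em[OF B(1)] capacity_measure_inner_regular[OF B(2)])
    also have "\<dots> \<le> (SUP C\<in>{C. compactin character_topology C \<and> C \<subseteq> B}. emeasure \<nu> C)"
    proof (rule SUP_least)
      fix C assume "C \<in> {C. compact C \<and> C \<subseteq> K \<inter> B}"
      then have "compactin character_topology C" "C \<subseteq> B" "C \<subseteq> ?X"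
        using B(1) by (auto simp: compactin_characters)
      then show "emeasure ?M C \<le> (SUP C\<in>{C. compactin character_topology C \<and> C \<subseteq> B}. emeasure \<nu> C)"
        by (intro SUP_upper2[of C]) (auto simp: em)
    qed
    finally have "emeasure \<nu> B \<le> (SUP C\<in>{C. compactin character_topology C \<and> C \<subseteq> B}. emeasure \<nu> C)" .
    moreover have "(SUP C\<in>{C. compactin character_topology C \<and> C \<subseteq> B}. emeasure \<nu> C) \<le> emeasure \<nu> B"
      using \<open>B \<in> sets \<nu>\<close> by (intro SUP_least emeasure_mono) auto
    ultimately show "emeasure \<nu> B = (SUP C\<in>{C. compactin character_topology C \<and> C \<subseteq> B}. emeasure \<nu> C)"
      by (rule antisym)
  qed
  have eval: "integrable \<nu> (\<lambda>\<alpha>. \<alpha> a) \<and> L a = (\<integral>\<alpha>. \<alpha> a \<partial>\<nu>)" for a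
  proof -
    let ?e = "\<lambda>\<alpha>::'a \<Rightarrow> real. \<alpha> a"
    have e: "?e \<in> evaluation_functions K" by (auto simp: evaluation_functions_def)
    have [measurable]: "?e \<in> borel_measurable borel"
      by (rule borel_measurable_continuous_onI[OF continuous_on_product_coordinates])
    have [measurable]: "K \<in> sets borel" using S_closed by (rule borel_closed)
    have AEeq: "AE \<alpha> in ?M. indicator K \<alpha> *\<^sub>R ?e \<alpha> = indicator ?X \<alpha> *\<^sub>R ?e \<alpha>"
      using AEK by eventually_elim (use K(2) in \<open>auto simp: indicator_def\<close>)
    have meas: "(\<lambda>\<alpha>. indicator K \<alpha> *\<^sub>R ?e \<alpha>) \<in> borel_measurable ?M"
      "(\<lambda>\<alpha>. indicator ?X \<alpha> *\<^sub>R ?e \<alpha>) \<in> borel_measurable ?M" by measurable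
    have "integrable ?M (\<lambda>\<alpha>. indicator ?X \<alpha> *\<^sub>R ?e \<alpha>)"
      using set_integrable_capacity[OF e] integrable_cong_AE[OF meas AEeq]
      unfolding set_integrable_def by blast
    moreover have "L a = (\<integral>\<alpha>. indicator K \<alpha> *\<^sub>R ?e \<alpha> \<partial>?M)"
      using \<Lambda>_eq_integral[OF e] \<Lambda>_eq[of ?e a] by (simp add: set_lebesgue_integral_def)
    moreover have "\<dots> = (\<integral>\<alpha>. indicator ?X \<alpha> *\<^sub>R ?e \<alpha> \<partial>?M)"
      by (rule integral_cong_AE[OF meas AEeq])
    ultimately show ?thesis
      unfolding \<nu>_def integrable_restrict_space[OF XM] integral_restrict_space[OF XM] by simp
  qed
  have supp: "measure_support character_topology \<nu> \<subseteq> K"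
  proof
    fix x assume x: "x \<in> measure_support character_topology \<nu>"
    show "x \<in> K"
    proof (rule ccontr)
      assume "x \<notin> K"
      have "openin (top_of_set ?X) (?X \<inter> - K)" using S_closed by (intro openin_open_Int) auto
      then have "0 < emeasure \<nu> (?X \<inter> - K)"
        using x \<open>x \<notin> K\<close> by (auto simp: measure_support_def character_topology_eq)
      moreover have "emeasure ?M (?X \<inter> - K) \<le> emeasure ?M (- K)"
        using S_closed by (intro emeasure_mono) (auto simp: sets_capacity_measure)
      ultimately show False using capacity_measure_null by (simp add: em)
    qed
  qed
  show thesis
  proof (rule that)
    show "representing_measure L \<nu>" using radon eval by (simp add: representing_measure_def)
    show "compactin character_topology (measure_support character_topology \<nu>)"
      by (rule closed_compactin[OF _ supp closedin_measure_support]) (simp add: compactin_characters K)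
  qed
qed

text \<open>
  By inner regularity of \<open>\<nu>\<close>, choose a compact set \<open>D\<close> disjoint from \<open>C\<close> that nearly exhausts the complement of \<open>C\<close>.
  An evaluation that on \<open>K\<close> is nearly 1 on \<open>C\<close>, nearly 0 on \<open>D\<close> and between 0 and 1 elsewhere has the same
  integral \<open>L a\<close> for both measures. That integral is at least \<open>\<mu> C\<close> and at most \<open>\<nu> C\<close>, up to small errors.
\<close>

lemma representing_compact_le:
  assumes rep: "representing_measure L \<mu>" "representing_measure L \<nu>" and one: "L 1 = 1"
    and K: "compact K" "K \<subseteq> characters" "AE \<alpha> in \<mu>. \<alpha> \<in> K" "AE \<alpha> in \<nu>. \<alpha> \<in> K"
    and C: "compact C" "C \<subseteq> characters"
  shows "measure \<mu> C \<le> measure \<nu> C"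
proof (rule field_le_epsilon)
  fix e0 :: real assume "0 < e0"
  define e where "e = min (e0/3) (1/2)"
  have e: "0 < e" "e < 1" "3 * e \<le> e0" using \<open>0 < e0\<close> by (auto simp: e_def)
  interpret \<mu>: finite_measure \<mu> by (rule total_mass_representing[OF rep(1) one])
  interpret \<nu>: finite_measure \<nu> by (rule total_mass_representing[OF rep(2) one])
  note \<mu>D = representing_measureD[OF rep(1)] and \<nu>D = representing_measureD[OF rep(2)]
  have prob: "measure \<mu> (space \<mu>) = 1" "measure \<nu> (space \<nu>) = 1"
    by (rule total_mass_representing[OF rep(1) one] total_mass_representing[OF rep(2) one])+
  have Cs: "C \<in> sets \<mu>" "C \<in> sets \<nu>"
    using closed_in_sets_representing compact_imp_closed C rep by blast+
  define N where "N = characters - C"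
  have N: "N \<in> sets \<nu>" unfolding N_def using Cs(2) sets.compl_sets[of C \<nu>] by (simp add: \<nu>D(2))
  have "\<exists>D. compact D \<and> D \<subseteq> N \<and> measure \<nu> N - e < measure \<nu> D"
  proof (rule ccontr)
    assume *: "\<not> ?thesis"
    have "emeasure \<nu> N = (SUP D\<in>{D. compactin character_topology D \<and> D \<subseteq> N}. emeasure \<nu> D)"
      using \<nu>D(1) N by (simp add: radon_measure_on_def)
    also have "\<dots> \<le> ennreal (measure \<nu> N - e)"
    proof (rule SUP_least)
      fix D assume "D \<in> {D. compactin character_topology D \<and> D \<subseteq> N}"
      then have "measure \<nu> D \<le> measure \<nu> N - e" using * by (auto simp: compactin_characters not_less)
      then show "emeasure \<nu> D \<le> ennreal (measure \<nu> N - e)"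
        by (simp add: \<nu>.emeasure_eq_measure ennreal_leI)
    qed
    finally have "ennreal (measure \<nu> N) \<le> ennreal (measure \<nu> N - e)"
      by (simp add: \<nu>.emeasure_eq_measure)
    moreover have "measure \<nu> {} \<le> measure \<nu> N - e"
      using * by (metis compact_empty empty_subsetI not_less)
    ultimately show False using e by (simp add: ennreal_le_iff)
  qed
  then obtain D where D: "compact D" "D \<subseteq> N" "measure \<nu> N - e < measure \<nu> D" by blast
  have Ds: "D \<in> sets \<nu>"
    by (rule closed_in_sets_representing[OF rep(2) compact_imp_closed[OF D(1)]]) (use D(2) N_def in blast)
  interpret function_ring_on "evaluation_functions K" K by (rule function_ring_evaluations[OF K(1,2)])
  have clK: "closed (D \<inter> K)" "closed (C \<inter> K)"
    using compact_imp_closed[OF K(1)] compact_imp_closed[OF D(1)] compact_imp_closed[OF C(1)] by auto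
  have "\<exists>f\<in>evaluation_functions K. f ` K \<subseteq> {0..1} \<and> (\<forall>x\<in>D \<inter> K. f x < e) \<and> (\<forall>x\<in>C \<inter> K. 1 - e < f x)"
    by (rule two[OF clK(1) _ clK(2) _ _ e(1,2)]) (use D(2) N_def in auto)
  then obtain f where f: "f \<in> evaluation_functions K" "f ` K \<subseteq> {0..1}" "\<forall>x\<in>D \<inter> K. f x < e"
    "\<forall>x\<in>C \<inter> K. 1 - e < f x" by blast
  then obtain a where fa: "\<forall>\<alpha>\<in>K. f \<alpha> = \<alpha> a" by (auto simp: evaluation_functions_def)
  have a: "0 \<le> \<alpha> a \<and> \<alpha> a \<le> 1" "\<alpha> \<in> D \<Longrightarrow> \<alpha> a < e" "\<alpha> \<in> C \<Longrightarrow> 1 - e < \<alpha> a" if "\<alpha> \<in> K" for \<alpha>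
    using f(2-4) fa that by (auto simp: image_subset_iff)
  have "(1 - e) * measure \<mu> C = (\<integral>\<alpha>. (1 - e) * indicator C \<alpha> \<partial>\<mu>)"
    using Cs by simp
  also have "\<dots> \<le> (\<integral>\<alpha>. \<alpha> a \<partial>\<mu>)"
  proof (rule integral_mono_AE)
    show "integrable \<mu> (\<lambda>\<alpha>. (1 - e) * indicator C \<alpha> :: real)"
      using Cs by (intro integrable_mult_right integrable_real_indicator) (simp_all add: less_top[symmetric])
    show "AE \<alpha> in \<mu>. (1 - e) * indicator C \<alpha> \<le> \<alpha> a"
      using K(3)
    proof eventually_elim
      case (elim \<alpha>)
      then show ?case using a(1)[OF elim] a(3)[OF elim] by (auto simp: indicator_def)
    qed
  qed (rule \<mu>D(4))
  also have "\<dots> = (\<integral>\<alpha>. \<alpha> a \<partial>\<nu>)" using \<mu>D(5)[of a] \<nu>D(5)[of a] by simp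
  also have "\<dots> \<le> (\<integral>\<alpha>. indicator C \<alpha> + (e + indicator (N - D) \<alpha>) \<partial>\<nu>)"
  proof (rule integral_mono_AE)
    show "integrable \<nu> (\<lambda>\<alpha>. indicator C \<alpha> + (e + indicator (N - D) \<alpha>) :: real)"
      using Cs N Ds by (intro Bochner_Integration.integrable_add integrable_real_indicator) (simp_all add: less_top[symmetric])
    show "AE \<alpha> in \<nu>. \<alpha> a \<le> indicator C \<alpha> + (e + indicator (N - D) \<alpha>)"
      using K(4)
    proof eventually_elim
      case (elim \<alpha>)
      have "\<alpha> \<in> C \<or> \<alpha> \<in> N" using elim K(2) by (auto simp: N_def)
      then show ?case using a(1)[OF elim] a(2)[OF elim] e by (auto simp: indicator_def)
    qed
  qed (rule \<nu>D(4))
  also have "\<dots> = measure \<nu> C + (e + measure \<nu> (N - D))"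
    using Cs N Ds prob by (simp add: less_top[symmetric])
  also have "measure \<nu> (N - D) = measure \<nu> N - measure \<nu> D"
    by (rule \<nu>.finite_measure_Diff[OF N Ds D(2)])
  finally have "measure \<mu> C \<le> measure \<nu> C + 2 * e + e * measure \<mu> C"
    using D(3) by (simp add: algebra_simps)
  also have "\<dots> \<le> measure \<nu> C + 2 * e + e * 1"
    using e \<mu>.bounded_measure[of C] prob by (intro add_left_mono mult_left_mono) auto
  finally show "measure \<mu> C \<le> measure \<nu> C + e0" using e by linarith
qed

lemma representing_measure_unique:
  assumes rep: "representing_measure L \<mu>" "representing_measure L \<nu>" and one: "L 1 = 1"
    and comp: "compactin character_topology (measure_support character_topology \<mu>)"
      "compactin character_topology (measure_support character_topology \<nu>)"
  shows "\<mu> = \<nu>"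
proof -
  obtain K1 where K1: "compact K1" "K1 \<subseteq> characters" "AE \<alpha> in \<mu>. \<alpha> \<in> K1"
    by (rule compact_support_AE[OF rep(1) comp(1)])
  obtain K2 where K2: "compact K2" "K2 \<subseteq> characters" "AE \<alpha> in \<nu>. \<alpha> \<in> K2"
    by (rule compact_support_AE[OF rep(2) comp(2)])
  have K: "compact (K1 \<union> K2)" "K1 \<union> K2 \<subseteq> characters"
    using K1 K2 by (auto intro: compact_Un)
  have AE: "AE \<alpha> in \<mu>. \<alpha> \<in> K1 \<union> K2" "AE \<alpha> in \<nu>. \<alpha> \<in> K1 \<union> K2"
    by (rule eventually_mono[OF K1(3)], simp) (rule eventually_mono[OF K2(3)], simp)
  interpret \<mu>: finite_measure \<mu> by (rule total_mass_representing[OF rep(1) one])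
  interpret \<nu>: finite_measure \<nu> by (rule total_mass_representing[OF rep(2) one])
  note \<mu>D = representing_measureD[OF rep(1)] and \<nu>D = representing_measureD[OF rep(2)]
  have eq: "emeasure \<mu> C = emeasure \<nu> C" if "compactin character_topology C" for C
  proof -
    have C: "compact C" "C \<subseteq> characters" using that by (simp_all add: compactin_characters)
    have "measure \<mu> C = measure \<nu> C"
      using representing_compact_le[OF rep one K AE C] representing_compact_le[OF rep(2,1) one K AE(2,1) C]
      by (rule antisym)
    then show ?thesis by (simp add: \<mu>.emeasure_eq_measure \<nu>.emeasure_eq_measure)
  qed
  show ?thesis
  proof (rule measure_eqI)
    show "sets \<mu> = sets \<nu>" by (simp add: \<mu>D(3) \<nu>D(3))
    fix B assume B: "B \<in> sets \<mu>"
    then have "emeasure \<mu> B = (SUP C\<in>{C. compactin character_topology C \<and> C \<subseteq> B}. emeasure \<mu> C)"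
      using \<mu>D(1) by (simp add: radon_measure_on_def)
    also have "\<dots> = (SUP C\<in>{C. compactin character_topology C \<and> C \<subseteq> B}. emeasure \<nu> C)"
      by (rule SUP_cong) (auto simp: eq)
    also have "\<dots> = emeasure \<nu> B"
      using \<nu>D(1) B \<open>sets \<mu> = sets \<nu>\<close> by (simp add: radon_measure_on_def)
    finally show "emeasure \<mu> B = emeasure \<nu> B" .
  qed
qed

theorem proposition2p7:
  fixes L :: "'a::{comm_ring_1, real_algebra_1} \<Rightarrow> real"
  assumes "(characters :: ('a \<Rightarrow> real) set) \<noteq> {}"
    and "linear L" and "L 1 = 1"
  shows "(\<exists>!\<nu>. representing_measure L \<nu> \<and>
            compactin character_topology (measure_support character_topology \<nu>))
    \<longleftrightarrow> (\<forall>a. root_sup_finite L a) \<and>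
        (\<forall>a. \<forall>j k :: nat.
           0 \<le> L ((of_real (C_const L a) - a) ^ j * (of_real (C_const L a) + a) ^ k))"
    (is "?unique \<longleftrightarrow> ?growth \<and> ?products")
proof
  assume ?unique
  then obtain \<nu> where \<nu>: "representing_measure L \<nu>"
    "compactin character_topology (measure_support character_topology \<nu>)"
    by blast
  have fin: "root_sup_finite L a" for a
    by (rule representing_imp_root_sup_finite[OF \<nu>(1) assms(3) \<nu>(2)])
  then show "?growth \<and> ?products"
    using representing_imp_products_nonneg[OF \<nu>(1) assms(3)] by blast
next
  assume "?growth \<and> ?products"
  then have fin: "root_sup_finite L a" for a by blast
  have "L \<in> states (C_const L)"
  proof (rule statesI[OF assms(2,3)])
    show "0 \<le> L (x^2)" for x
      using fin[of x, unfolded root_sup_finite_def, THEN conjunct1, rule_format, of 1] by simp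
    show "\<exists>M. \<forall>n\<ge>1. L (b^(2*n)) \<le> M * ((C_const L b)^2)^n" for b
      using root_sup_finiteD(2)[OF fin] by (intro exI[of _ 1]) (simp add: power_mult)
  qed
  then have pos: "0 \<le> L a" if "\<And>\<alpha>. \<alpha> \<in> bounded_characters (C_const L) \<Longrightarrow> 0 \<le> \<alpha> a" for a
    using that by (rule state_nonneg)
  have "bounded_characters (C_const L) \<subseteq> characters" by (auto simp: bounded_characters_def)
  from representing_measure_exists[OF assms(2,3) compact_bounded_characters this pos]
  obtain \<nu> where "representing_measure L \<nu>"
    "compactin character_topology (measure_support character_topology \<nu>)" by blast
  then show ?unique
    using representing_measure_unique[where L = L] assms(3) by blast
qed

end
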